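(* Let $\lambda>0$ and $1<p<\infty$. A subset $\mathcal{F}$ of $L^p(\mathbb{R}_+,dm_\lambda)$ is totally bounded (equivalently, relatively compact) if and only if the following statements hold: (a) $\mathcal{F}$ is uniformly bounded, i.e., $\sup_{f\in\mathcal{F}}\|f\|_{L^p(\mathbb{R}_+,dm_\lambda)}<\infty$; (b) $\mathcal{F}$ uniformly vanishes at infinity, i.e., for every $\epsilon>0$ there exists a positive constant $M$ such that for every $f\in\mathcal{F}$, $$\int_M^\infty|f(x)|^p x^{2\lambda}\,dx<\epsilon^p;$$ (c) $\mathcal{F}$ is uniformly equicontinuous, i.e., for every $\epsilon>0$ there exists a positive constant $\rho$ such that for every $f\in\mathcal{F}$ and every $y\in\mathbb{R}_+$ with $y<\rho$, $$\int_0^\infty|f(x+y)-f(x)|^p x^{2\lambda}\,dx<\epsilon^p.$$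
   Context: $\mathbb{R}_+:=(0,\infty)$, $\lambda>0$ is fixed, $dm_\lambda(x):=x^{2\lambda}\,dx$. *)

theory Defs
  imports "HOL-Analysis.Analysis"
begin

section \<open>The Lebesgue spaces \<open>L^p\<close> as metric spaces of a.e.-equivalence classes\<close>

definition Lp_fun :: "'a measure \<Rightarrow> real \<Rightarrow> ('a \<Rightarrow> complex) set" where
  "Lp_fun M p = {f \<in> borel_measurable M. integrable M (\<lambda>x. norm (f x) powr p)}"

definition Lp_seminorm :: "'a measure \<Rightarrow> real \<Rightarrow> ('a \<Rightarrow> complex) \<Rightarrow> real" where
  "Lp_seminorm M p f = (\<integral>x. norm (f x) powr p \<partial>M) powr (1 / p)"

definition Lp_rel :: "'a measure \<Rightarrow> real \<Rightarrow> (('a \<Rightarrow> complex) \<times> ('a \<Rightarrow> complex)) set" where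
  "Lp_rel M p = {(f, g). f \<in> Lp_fun M p \<and> g \<in> Lp_fun M p \<and> (AE x in M. f x = g x)}"

definition Lp_space :: "'a measure \<Rightarrow> real \<Rightarrow> ('a \<Rightarrow> complex) set set" where
  "Lp_space M p = Lp_fun M p // Lp_rel M p"

text \<open>The norm and the distance are computed from chosen representatives. They do not depend on
  the choice, by lemmas \<open>Lp_norm_eq\<close> and \<open>Lp_dist_eq\<close>.\<close>

definition Lp_norm :: "'a measure \<Rightarrow> real \<Rightarrow> ('a \<Rightarrow> complex) set \<Rightarrow> real" where
  "Lp_norm M p C = Lp_seminorm M p (SOME f. f \<in> C)"

definition Lp_dist ::
    "'a measure \<Rightarrow> real \<Rightarrow> ('a \<Rightarrow> complex) set \<Rightarrow> ('a \<Rightarrow> complex) set \<Rightarrow> real" where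
  "Lp_dist M p C D = Lp_seminorm M p (\<lambda>x. (SOME f. f \<in> C) x - (SOME g. g \<in> D) x)"

text \<open>The measure \<open>x powr (2 * l) dx\<close> on the open half-line. Representatives of classes over it
  are unconstrained outside \<open>{0<..}\<close>.\<close>

definition bessel_measure :: "real \<Rightarrow> real measure" where
  "bessel_measure l = density (restrict_space lborel {0<..}) (\<lambda>x. ennreal (x powr (2 * l)))"

abbreviation Lp_totally_bounded :: "'a measure \<Rightarrow> real \<Rightarrow> ('a \<Rightarrow> complex) set set \<Rightarrow> bool" where
  "Lp_totally_bounded M p \<equiv> Metric_space.mtotally_bounded (Lp_space M p) (Lp_dist M p)"

abbreviation Lp_topology :: "'a measure \<Rightarrow> real \<Rightarrow> ('a \<Rightarrow> complex) set topology" where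
  "Lp_topology M p \<equiv> Metric_space.mtopology (Lp_space M p) (Lp_dist M p)"


subsection \<open>The definitions do yield a metric space\<close>

lemma equiv_Lp_rel: "equiv (Lp_fun M p) (Lp_rel M p)"
proof (rule equivI)
  show "Lp_rel M p \<subseteq> Lp_fun M p \<times> Lp_fun M p" by (auto simp: Lp_rel_def)
  show "refl_on (Lp_fun M p) (Lp_rel M p)" by (auto simp: refl_on_def Lp_rel_def)
  show "sym (Lp_rel M p)"
    by (rule symI) (auto simp: Lp_rel_def elim!: eventually_mono)
  show "trans (Lp_rel M p)"
  proof (rule transI)
    fix f g h assume "(f, g) \<in> Lp_rel M p" "(g, h) \<in> Lp_rel M p"
    then have AE: "AE x in M. f x = g x" "AE x in M. g x = h x"
      and *: "f \<in> Lp_fun M p" "h \<in> Lp_fun M p"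
      by (auto simp: Lp_rel_def)
    from AE have "AE x in M. f x = h x" by eventually_elim simp
    then show "(f, h) \<in> Lp_rel M p" using * by (simp add: Lp_rel_def)
  qed
qed

lemma Lp_space_rep:
  assumes "C \<in> Lp_space M p"
  obtains f where "f \<in> C" "f \<in> Lp_fun M p" "C = Lp_rel M p `` {f}"
  using assms equiv_Lp_rel[of M p] unfolding Lp_space_def
  by (metis equiv_class_self quotientE)

lemma Lp_space_repD:
  assumes "C \<in> Lp_space M p" "f \<in> C" "g \<in> C"
  shows "f \<in> Lp_fun M p" "g \<in> Lp_fun M p" "AE x in M. f x = g x"
  using assms quotient_eq_iff[OF equiv_Lp_rel[of M p], of C C f g]
  by (auto simp: Lp_space_def Lp_rel_def)

lemma Lp_seminorm_cong_AE:
  assumes [measurable]: "f \<in> borel_measurable M" "g \<in> borel_measurable M"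
    and "AE x in M. f x = g x"
  shows "Lp_seminorm M p f = Lp_seminorm M p g"
proof -
  have "(\<integral>x. norm (f x) powr p \<partial>M) = (\<integral>x. norm (g x) powr p \<partial>M)"
    by (rule integral_cong_AE) (use assms(3) in auto)
  then show ?thesis by (simp add: Lp_seminorm_def)
qed

lemma Lp_norm_eq:
  assumes "C \<in> Lp_space M p" "f \<in> C"
  shows "Lp_norm M p C = Lp_seminorm M p f"
proof -
  have "(SOME f. f \<in> C) \<in> C" using assms(2) by (simp add: some_in_eq) blast
  note F = Lp_space_repD[OF assms(1) this assms(2)]
  show ?thesis
    unfolding Lp_norm_def using F by (intro Lp_seminorm_cong_AE) (auto simp: Lp_fun_def)
qed

lemma Lp_dist_eq:
  assumes "C \<in> Lp_space M p" "D \<in> Lp_space M p" "f \<in> C" "g \<in> D"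
  shows "Lp_dist M p C D = Lp_seminorm M p (\<lambda>x. f x - g x)"
proof -
  define f' where "f' = (SOME f. f \<in> C)"
  define g' where "g' = (SOME g. g \<in> D)"
  have "f' \<in> C" "g' \<in> D"
    unfolding f'_def g'_def using assms(3,4) by (auto simp: some_in_eq)
  note F = Lp_space_repD[OF assms(1) \<open>f' \<in> C\<close> assms(3)]
  note G = Lp_space_repD[OF assms(2) \<open>g' \<in> D\<close> assms(4)]
  have [measurable]: "f' \<in> borel_measurable M" "f \<in> borel_measurable M"
    "g' \<in> borel_measurable M" "g \<in> borel_measurable M"
    using F G by (auto simp: Lp_fun_def)
  have "AE x in M. f' x - g' x = f x - g x"
    using F(3) G(3) by eventually_elim simp
  then have "Lp_seminorm M p (\<lambda>x. f' x - g' x) = Lp_seminorm M p (\<lambda>x. f x - g x)"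
    by (intro Lp_seminorm_cong_AE) auto
  then show ?thesis by (simp add: Lp_dist_def f'_def g'_def)
qed

lemma powr_convex_nonneg:
  fixes t u v p :: real
  assumes "1 \<le> p" "0 < t" "t < 1" "0 \<le> u" "0 \<le> v"
  shows "(t * u + (1 - t) * v) powr p \<le> t * u powr p + (1 - t) * v powr p"
proof -
  have scale: "(s * w) powr p \<le> s * w powr p" if "0 < s" "s < 1" "0 \<le> w" for s w :: real
  proof -
    have "s powr p \<le> s powr 1" using that assms(1) by (intro powr_mono') auto
    then show ?thesis using that by (simp add: powr_mult mult_right_mono)
  qed
  consider "u = 0" | "v = 0" | "0 < u" "0 < v" using assms by fastforce
  then show ?thesis
  proof cases
    case 1
    then show ?thesis using scale[of "1 - t" v] assms by simp
  next
    case 2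
    then show ?thesis using scale[of t u] assms by simp
  next
    case 3
    then show ?thesis
      using convex_onD[OF powr_convex[OF assms(1)], of "1 - t" u v] assms by simp
  qed
qed

lemma Lp_add_bound:
  assumes p: "1 \<le> p" and f: "f \<in> Lp_fun M p" and g: "g \<in> Lp_fun M p"
    and a: "Lp_seminorm M p f < a" and b: "Lp_seminorm M p g < b"
  shows "(\<lambda>x. f x + g x) \<in> Lp_fun M p" "Lp_seminorm M p (\<lambda>x. f x + g x) \<le> a + b"
proof -
  have pos: "0 < a" "0 < b"
    using a b by (auto simp: Lp_seminorm_def intro: le_less_trans[OF powr_ge_zero])
  have [measurable]: "f \<in> borel_measurable M" "g \<in> borel_measurable M"
    and intf: "integrable M (\<lambda>x. norm (f x) powr p)"
    and intg: "integrable M (\<lambda>x. norm (g x) powr p)"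
    using f g by (auto simp: Lp_fun_def)
  have small: "(\<integral>x. norm (h x) powr p \<partial>M) \<le> c powr p" if "Lp_seminorm M p h < c" for h c
  proof -
    let ?I = "\<integral>x. norm (h x) powr p \<partial>M"
    have "0 \<le> ?I" by simp
    then have "?I = (?I powr (1 / p)) powr p" using p by (simp add: powr_powr)
    also have "\<dots> \<le> c powr p" using that p by (intro powr_mono2) (auto simp: Lp_seminorm_def)
    finally show ?thesis .
  qed
  define t where "t = a / (a + b)"
  have t: "0 < t" "t < 1" and t': "1 - t = b / (a + b)"
    using pos by (auto simp: t_def field_simps)
  let ?B = "\<lambda>x. (a + b) powr p *
    (t * (norm (f x) powr p / a powr p) + (1 - t) * (norm (g x) powr p / b powr p))"
  have bound: "norm (f x + g x) powr p \<le> ?B x" for x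
  proof -
    have "norm (f x) + norm (g x) = (a + b) * (t * (norm (f x) / a) + (1 - t) * (norm (g x) / b))"
      using pos unfolding t' unfolding t_def by (simp add: distrib_left)
    moreover have "norm (f x + g x) powr p \<le> (norm (f x) + norm (g x)) powr p"
      using p by (intro powr_mono2 norm_triangle_ineq) auto
    moreover have "(t * (norm (f x) / a) + (1 - t) * (norm (g x) / b)) powr p
        \<le> t * (norm (f x) / a) powr p + (1 - t) * (norm (g x) / b) powr p"
      using p t pos by (intro powr_convex_nonneg) auto
    ultimately show ?thesis
      using pos t by (simp add: powr_mult powr_divide mult_left_mono order_trans)
  qed
  have intB: "integrable M ?B" using intf intg by auto
  have int: "integrable M (\<lambda>x. norm (f x + g x) powr p)"
  proof (rule Bochner_Integration.integrable_bound[OF intB])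
    have "norm (norm (f x + g x) powr p) \<le> norm (?B x)" for x
      unfolding real_norm_def by (rule order_trans[OF _ abs_ge_self]) (use bound[of x] in simp)
    then show "AE x in M. norm (norm (f x + g x) powr p) \<le> norm (?B x)" by simp
  qed simp
  then show "(\<lambda>x. f x + g x) \<in> Lp_fun M p" by (simp add: Lp_fun_def)
  have "(\<integral>x. norm (f x + g x) powr p \<partial>M) \<le> (\<integral>x. ?B x \<partial>M)"
    by (rule integral_mono[OF int intB bound])
  also have "\<dots> = (a + b) powr p *
      (t * ((\<integral>x. norm (f x) powr p \<partial>M) / a powr p) +
       (1 - t) * ((\<integral>x. norm (g x) powr p \<partial>M) / b powr p))"
    using intf intg by simp
  also have "\<dots> \<le> (a + b) powr p * (t * 1 + (1 - t) * 1)"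
    using small[OF a] small[OF b] t pos
    by (intro mult_left_mono add_mono) auto
  finally have "(\<integral>x. norm (f x + g x) powr p \<partial>M) \<le> (a + b) powr p" by simp
  then have "Lp_seminorm M p (\<lambda>x. f x + g x) \<le> ((a + b) powr p) powr (1 / p)"
    unfolding Lp_seminorm_def using p by (intro powr_mono2) auto
  also have "\<dots> = a + b" using p pos by (simp add: powr_powr)
  finally show "Lp_seminorm M p (\<lambda>x. f x + g x) \<le> a + b" .
qed

lemma Lp_fun_add:
  assumes "1 \<le> p" "f \<in> Lp_fun M p" "g \<in> Lp_fun M p"
  shows "(\<lambda>x. f x + g x) \<in> Lp_fun M p"
  using Lp_add_bound(1)[OF assms] less_add_one by blast

lemma Lp_fun_diff:
  assumes "1 \<le> p" "f \<in> Lp_fun M p" "g \<in> Lp_fun M p"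
  shows "(\<lambda>x. f x - g x) \<in> Lp_fun M p"
proof -
  have "(\<lambda>x. - g x) \<in> Lp_fun M p" using assms(3) by (simp add: Lp_fun_def)
  from Lp_fun_add[OF assms(1,2) this] show ?thesis by simp
qed

lemma Lp_seminorm_triangle:
  assumes "1 \<le> p" "f \<in> Lp_fun M p" "g \<in> Lp_fun M p"
  shows "Lp_seminorm M p (\<lambda>x. f x + g x) \<le> Lp_seminorm M p f + Lp_seminorm M p g"
proof (rule field_le_epsilon)
  fix e :: real assume "0 < e"
  then have "Lp_seminorm M p (\<lambda>x. f x + g x) \<le>
      (Lp_seminorm M p f + e / 2) + (Lp_seminorm M p g + e / 2)"
    by (intro Lp_add_bound(2)[OF assms]) auto
  then show "Lp_seminorm M p (\<lambda>x. f x + g x) \<le> Lp_seminorm M p f + Lp_seminorm M p g + e"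
    by simp
qed

lemma Lp_seminorm_eq_0_iff:
  assumes "1 \<le> p" "f \<in> Lp_fun M p"
  shows "Lp_seminorm M p f = 0 \<longleftrightarrow> (AE x in M. f x = 0)"
  using assms integral_nonneg_eq_0_iff_AE[of M "\<lambda>x. norm (f x) powr p"]
  by (simp add: Lp_seminorm_def Lp_fun_def)

theorem Metric_space_Lp:
  assumes p: "1 \<le> p"
  shows "Metric_space (Lp_space M p) (Lp_dist M p)"
proof
  show "0 \<le> Lp_dist M p C D" for C D
    by (simp add: Lp_dist_def Lp_seminorm_def)
  show "Lp_dist M p C D = Lp_dist M p D C" for C D
    by (simp add: Lp_dist_def Lp_seminorm_def norm_minus_commute)
  show "Lp_dist M p C D = 0 \<longleftrightarrow> C = D"
    if C: "C \<in> Lp_space M p" and D: "D \<in> Lp_space M p" for C D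
  proof -
    obtain f where f: "f \<in> C" "f \<in> Lp_fun M p" "C = Lp_rel M p `` {f}" by (rule Lp_space_rep[OF C])
    obtain g where g: "g \<in> D" "g \<in> Lp_fun M p" "D = Lp_rel M p `` {g}" by (rule Lp_space_rep[OF D])
    have "Lp_dist M p C D = 0 \<longleftrightarrow> (AE x in M. f x = g x)"
      using Lp_seminorm_eq_0_iff[OF p Lp_fun_diff[OF p f(2) g(2)]]
      by (simp add: Lp_dist_eq[OF C D f(1) g(1)])
    also have "\<dots> \<longleftrightarrow> (f, g) \<in> Lp_rel M p" using f(2) g(2) by (simp add: Lp_rel_def)
    also have "\<dots> \<longleftrightarrow> C = D"
      using eq_equiv_class_iff[OF equiv_Lp_rel f(2) g(2)] f(3) g(3) by simp
    finally show ?thesis .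
  qed
  show "Lp_dist M p C E \<le> Lp_dist M p C D + Lp_dist M p D E"
    if C: "C \<in> Lp_space M p" and D: "D \<in> Lp_space M p" and E: "E \<in> Lp_space M p" for C D E
  proof -
    obtain f where f: "f \<in> C" "f \<in> Lp_fun M p" by (rule Lp_space_rep[OF C])
    obtain g where g: "g \<in> D" "g \<in> Lp_fun M p" by (rule Lp_space_rep[OF D])
    obtain h where h: "h \<in> E" "h \<in> Lp_fun M p" by (rule Lp_space_rep[OF E])
    from Lp_seminorm_triangle[OF p Lp_fun_diff[OF p f(2) g(2)] Lp_fun_diff[OF p g(2) h(2)]]
    show ?thesis
      by (simp add: Lp_dist_eq[OF C E f(1) h(1)] Lp_dist_eq[OF C D f(1) g(1)]
          Lp_dist_eq[OF D E g(1) h(1)])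
  qed
qed

end

theory Submission
  imports Defs
begin

text \<open>Given (a)--(c), conditions (b) and (c) make \<open>f\<close> uniformly small near infinity and near the
  origin, the latter because translating right increases the weight. In between, cut the half-line
  into cells of length \<open>h\<close> and replace \<open>f\<close> on each cell by its value at offset \<open>t\<close>. Averaged over
  \<open>t\<close>, the error is controlled by the translations of length less than \<open>h\<close>, so some \<open>t\<close> is good.
  The sampled values are bounded by (a), and rounding them leaves finitely many step functions.
  Conversely, a finite net reduces (b) and (c) to a single \<open>f\<close>, where (c) is continuity of
  translation in the weighted space.\<close>

section \<open>The \<open>p\<close>-th power of the norm\<close>

text \<open>Sampling is done on one fixed representative: a value at a prescribed point means
  nothing for a class, but Tonelli for a nonnegative kernel yields an offset at which the values of
  that representative are typical. The offset varies with \<open>f\<close>; this does no harm,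
  because an approximating step function is determined by its list of values alone, so the net is
  the same for all \<open>f\<close>. The obstacle is the origin. The weight degenerates there, and
  two points of a cell have comparable weights only away from 0, so the first cell cannot be sampled
  and needs its own estimate. Only right translations act on the half-line, and they never increase
  the norm because the weight is increasing; this also drives the perturbation argument in the
  converse. Estimates are made for the p-th power of the norm as an extended nonnegative integral:
  measurability then suffices, the domain can be split additively, and Tonelli applies. The price is
  a factor \<open>2 powr p\<close> per triangle inequality, absorbed by shrinking epsilon.
  Completeness serves only the equivalence of total boundedness with compact closure.\<close>

definition Lp_mass :: "'a measure \<Rightarrow> real \<Rightarrow> ('a \<Rightarrow> complex) \<Rightarrow> ennreal" where
  "Lp_mass M p f = (\<integral>\<^sup>+x. ennreal (norm (f x) powr p) \<partial>M)"

lemma Lp_fun_iff: "f \<in> Lp_fun M p \<longleftrightarrow> f \<in> borel_measurable M \<and> Lp_mass M p f < \<infinity>"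
  by (auto simp: Lp_fun_def Lp_mass_def integrable_iff_bounded)

lemma Lp_funD [measurable_dest]: "f \<in> Lp_fun M p \<Longrightarrow> f \<in> borel_measurable M"
  by (simp add: Lp_fun_def)

lemma Lp_mass_eq_seminorm:
  assumes "0 < p" "f \<in> Lp_fun M p"
  shows "Lp_mass M p f = ennreal (Lp_seminorm M p f powr p)"
  using assms by (simp add: Lp_mass_def Lp_seminorm_def Lp_fun_def nn_integral_eq_integral powr_powr)

lemma Lp_seminorm_nonneg: "0 \<le> Lp_seminorm M p f"
  by (simp add: Lp_seminorm_def)

lemma Lp_seminorm_less_iff:
  assumes "0 < p" "f \<in> Lp_fun M p" "0 < e"
  shows "Lp_seminorm M p f < e \<longleftrightarrow> Lp_mass M p f < ennreal (e powr p)"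
proof -
  have "Lp_seminorm M p f < e \<longleftrightarrow> Lp_seminorm M p f powr p < e powr p"
    using assms powr_less_mono2[of p "Lp_seminorm M p f" e] powr_mono2[of p e "Lp_seminorm M p f"]
      Lp_seminorm_nonneg[of M p f]
    by (metis less_imp_le not_less)
  then show ?thesis
    using assms by (simp add: Lp_mass_eq_seminorm ennreal_less_iff)
qed

text \<open>The larger of the two norms dominates half of the sum. Being pointwise, this substitute
  for Minkowski's inequality survives restriction to any subset of the half-line.\<close>

lemma norm_add_powr_le:
  fixes a b :: "'a::real_normed_vector"
  assumes "0 \<le> p"
  shows "norm (a + b) powr p \<le> 2 powr p * (norm a powr p + norm b powr p)"
proof -
  have "norm (a + b) \<le> 2 * max (norm a) (norm b)"
    using norm_triangle_ineq[of a b] by linarith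
  then have "norm (a + b) powr p \<le> (2 * max (norm a) (norm b)) powr p"
    using assms by (intro powr_mono2) auto
  also have "\<dots> = 2 powr p * max (norm a) (norm b) powr p"
    by (simp add: powr_mult)
  also have "\<dots> \<le> 2 powr p * (norm a powr p + norm b powr p)"
    by (intro mult_left_mono) (auto simp: max_def)
  finally show ?thesis .
qed

lemma ennreal_norm_diff_powr_le:
  fixes a b c :: "'a::real_normed_vector"
  assumes "0 \<le> p"
  shows "ennreal (norm (a - c) powr p) \<le>
    ennreal (2 powr p) * (ennreal (norm (a - b) powr p) + ennreal (norm (b - c) powr p))"
  using norm_add_powr_le[OF assms, of "a - b" "b - c"]
  by (simp flip: ennreal_plus ennreal_mult add: ennreal_leI)

lemma Lp_mass_diff_le:
  assumes "0 \<le> p" and [measurable]: "f \<in> borel_measurable M" "g \<in> borel_measurable M"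
    "h \<in> borel_measurable M"
  shows "Lp_mass M p (\<lambda>x. f x - h x) \<le>
    ennreal (2 powr p) * (Lp_mass M p (\<lambda>x. f x - g x) + Lp_mass M p (\<lambda>x. g x - h x))"
proof -
  have "Lp_mass M p (\<lambda>x. f x - h x) \<le> (\<integral>\<^sup>+x. ennreal (2 powr p) *
      (ennreal (norm (f x - g x) powr p) + ennreal (norm (g x - h x) powr p)) \<partial>M)"
    unfolding Lp_mass_def by (intro nn_integral_mono ennreal_norm_diff_powr_le assms)
  also have "\<dots> = ennreal (2 powr p) *
      (Lp_mass M p (\<lambda>x. f x - g x) + Lp_mass M p (\<lambda>x. g x - h x))"
    unfolding Lp_mass_def by (simp add: nn_integral_cmult nn_integral_add)
  finally show ?thesis .
qed

lemma Lp_mass_commute: "Lp_mass M p (\<lambda>x. f x - g x) = Lp_mass M p (\<lambda>x. g x - f x)"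
  by (simp add: Lp_mass_def norm_minus_commute)

text \<open>The bridge from metric balls to masses. The representatives are arbitrary, so later
  arguments may choose convenient ones.\<close>

lemma Lp_dist_less_iff:
  assumes "1 \<le> p" "C \<in> Lp_space M p" "D \<in> Lp_space M p" "f \<in> C" "g \<in> D" "0 < e"
  shows "Lp_dist M p C D < e \<longleftrightarrow> Lp_mass M p (\<lambda>x. f x - g x) < ennreal (e powr p)"
  using assms Lp_seminorm_less_iff[of p "\<lambda>x. f x - g x" M e]
    Lp_fun_diff[OF assms(1), of f M g] Lp_space_repD(1)[OF assms(2,4,4)]
    Lp_space_repD(1)[OF assms(3,5,5)]
  by (simp add: Lp_dist_eq[OF assms(2-5)])

section \<open>Completeness\<close>

text \<open>The differences \<open>d\<^sub>k\<close> of a subsequence have norm at most \<open>4\<^sup>-\<^sup>k\<close>. Hence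
  \<open>\<Sum>\<^sub>k (2\<^sup>k \<bar>d\<^sub>k\<bar>)\<^sup>p\<close> is integrable, which forces \<open>\<bar>d\<^sub>k\<bar> \<le> 2\<^sup>-\<^sup>k\<close> eventually, almost everywhere.\<close>

lemma AE_convergent_of_fast_Cauchy:
  fixes g :: "nat \<Rightarrow> 'a \<Rightarrow> complex"
  assumes p: "1 \<le> p" and [measurable]: "\<And>k. g k \<in> borel_measurable M"
    and small: "\<And>k. Lp_mass M p (\<lambda>x. g (Suc k) x - g k x) \<le> ennreal (((1/4)^k) powr p)"
  shows "AE x in M. convergent (\<lambda>k. g k x)"
proof -
  let ?u = "\<lambda>k x. ennreal ((2^k * norm (g (Suc k) x - g k x)) powr p)"
  have le: "(\<integral>\<^sup>+x. ?u k x \<partial>M) \<le> ennreal ((1/2)^k)" for k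
  proof -
    have "(\<integral>\<^sup>+x. ?u k x \<partial>M) = ennreal ((2^k) powr p) * Lp_mass M p (\<lambda>x. g (Suc k) x - g k x)"
      unfolding Lp_mass_def by (subst nn_integral_cmult[symmetric])
        (auto simp: powr_mult ennreal_mult intro!: nn_integral_cong)
    also have "\<dots> \<le> ennreal ((2^k) powr p) * ennreal (((1/4)^k) powr p)"
      by (intro mult_left_mono small) auto
    also have "\<dots> = ennreal (((1/2)^k) powr p)"
      by (simp flip: ennreal_mult powr_mult power_mult_distrib)
    also have "\<dots> \<le> ennreal ((1/2)^k)"
    proof (intro ennreal_leI)
      have "((1/2::real)^k) powr p \<le> ((1/2)^k) powr 1"
        using p by (intro powr_mono') (auto simp: power_le_one)
      then show "((1/2::real)^k) powr p \<le> (1/2)^k" by simp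
    qed
    finally show ?thesis .
  qed
  have "(\<integral>\<^sup>+x. (\<Sum>k. ?u k x) \<partial>M) = (\<Sum>k. \<integral>\<^sup>+x. ?u k x \<partial>M)"
    by (rule nn_integral_suminf) simp
  also have "\<dots> \<le> (\<Sum>k. ennreal ((1/2)^k))"
    by (intro suminf_le le) auto
  also have "\<dots> = ennreal (\<Sum>k. (1/2)^k)"
    by (intro suminf_ennreal2) (auto simp: summable_geometric)
  finally have "(\<integral>\<^sup>+x. (\<Sum>k. ?u k x) \<partial>M) \<noteq> \<infinity>"
    by (auto simp: top_unique)
  then have "AE x in M. (\<Sum>k. ?u k x) \<noteq> \<infinity>"
    by (intro nn_integral_PInf_AE) auto
  then show ?thesis
  proof eventually_elim
    case (elim x)
    let ?d = "\<lambda>k. g (Suc k) x - g k x"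
    have "summable (\<lambda>k. (2^k * norm (?d k)) powr p)"
      using elim by (intro summable_suminf_not_top) (auto simp: infinity_ennreal_def)
    then have "(\<lambda>k. (2^k * norm (?d k)) powr p) \<longlonglongrightarrow> 0"
      by (rule summable_LIMSEQ_zero)
    then have "\<forall>\<^sub>F k in sequentially. (2^k * norm (?d k)) powr p < 1"
      by (rule order_tendstoD) simp
    then have "\<forall>\<^sub>F k in sequentially. norm (?d k) \<le> (1/2)^k"
    proof eventually_elim
      case (elim k)
      have "2^k * norm (?d k) \<le> 1"
      proof (rule ccontr)
        assume "\<not> ?thesis"
        then have "1 \<le> (2^k * norm (?d k)) powr p"
          using p by (intro ge_one_powr_ge_zero) auto
        with elim show False by simp
      qed
      then show ?case by (simp add: power_divide field_simps)
    qed
    then have "summable ?d"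
      by (rule summable_comparison_test_ev) (simp add: summable_geometric)
    then have "convergent (\<lambda>n. \<Sum>k<n. ?d k)"
      by (simp add: summable_iff_convergent)
    then have "convergent (\<lambda>n. g n x - g 0 x)"
      by (simp only: sum_lessThan_telescope[of "\<lambda>k. g k x"])
    from convergent_add[OF this convergent_const[of "g 0 x"]] show ?case by simp
  qed
qed

text \<open>The limit is built pointwise along a rapidly Cauchy subsequence; Fatou's lemma along
  that subsequence then gives convergence of the whole sequence.\<close>

lemma Cauchy_Lp_limit:
  fixes f :: "nat \<Rightarrow> 'a \<Rightarrow> complex"
  assumes p: "1 \<le> p" and f: "\<And>n. f n \<in> Lp_fun M p"
    and Cauchy: "\<And>e. 0 < e \<Longrightarrow> \<exists>N. \<forall>m\<ge>N. \<forall>n\<ge>N. Lp_mass M p (\<lambda>x. f m x - f n x) < ennreal (e powr p)"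
  obtains G where "G \<in> Lp_fun M p"
    "\<And>e. 0 < e \<Longrightarrow> \<exists>N. \<forall>n\<ge>N. Lp_mass M p (\<lambda>x. f n x - G x) < ennreal (e powr p)"
proof -
  have [measurable]: "f n \<in> borel_measurable M" for n using f by measurable
  have "\<exists>N. \<forall>k. \<forall>m\<ge>N k. \<forall>n\<ge>N k. Lp_mass M p (\<lambda>x. f m x - f n x) < ennreal (((1/4)^k) powr p)"
    by (intro choice allI Cauchy) simp
  then obtain N where N: "\<And>k m n. N k \<le> m \<Longrightarrow> N k \<le> n \<Longrightarrow>
      Lp_mass M p (\<lambda>x. f m x - f n x) < ennreal (((1/4)^k) powr p)"
    by blast
  \<comment> \<open>Partial sums of \<open>Suc (N i)\<close> are strictly increasing and dominate
    every \<open>N k\<close>, so \<open>N\<close> need not be monotone.\<close>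
  define r where "r k = (\<Sum>i\<le>k. Suc (N i))" for k
  have "strict_mono r" by (rule strict_monoI_Suc) (simp add: r_def)
  have rN: "N k \<le> r k" for k by (cases k) (auto simp: r_def)
  define g where "g k = f (r k)" for k
  have [measurable]: "g k \<in> borel_measurable M" for k by (simp add: g_def)
  have "AE x in M. convergent (\<lambda>k. g k x)"
  proof (rule AE_convergent_of_fast_Cauchy[OF p])
    fix k
    have "N k \<le> r (Suc k)" using rN[of k] by (simp add: r_def)
    then show "Lp_mass M p (\<lambda>x. g (Suc k) x - g k x) \<le> ennreal (((1/4)^k) powr p)"
      unfolding g_def using N[of k "r (Suc k)" "r k"] rN[of k] by (simp add: less_imp_le)
  qed simp
  then have lim: "AE x in M. (\<lambda>k. g k x) \<longlonglongrightarrow> lim (\<lambda>k. g k x)"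
    by eventually_elim (simp add: convergent_LIMSEQ_iff)
  \<comment> \<open>\<open>lim\<close> is total, so \<open>G\<close> is defined and measurable
    everywhere; its arbitrary values where the subsequence diverges sit on a null set.\<close>
  define G where "G x = lim (\<lambda>k. g k x)" for x
  have G [measurable]: "G \<in> borel_measurable M"
    unfolding G_def by measurable
  have close: "\<exists>N. \<forall>n\<ge>N. Lp_mass M p (\<lambda>x. f n x - G x) < ennreal (e powr p)" if e: "0 < e" for e
  proof -
    \<comment> \<open>Fatou returns only a weak inequality, hence \<open>e/2\<close> here to end
      strictly below \<open>e\<close>.\<close>
    obtain N where N: "\<And>m n. N \<le> m \<Longrightarrow> N \<le> n \<Longrightarrow>
        Lp_mass M p (\<lambda>x. f m x - f n x) < ennreal ((e/2) powr p)"
      using Cauchy[of "e/2"] e by (metis half_gt_zero)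
    have "Lp_mass M p (\<lambda>x. f n x - G x) < ennreal (e powr p)" if n: "N \<le> n" for n
    proof -
      have "Lp_mass M p (\<lambda>x. f n x - G x)
          = (\<integral>\<^sup>+x. liminf (\<lambda>k. ennreal (norm (f n x - g k x) powr p)) \<partial>M)"
        unfolding Lp_mass_def
      proof (intro nn_integral_cong_AE, use lim in eventually_elim)
        case (elim x)
        have "(\<lambda>k. ennreal (norm (f n x - g k x) powr p)) \<longlonglongrightarrow> ennreal (norm (f n x - G x) powr p)"
          using elim p unfolding G_def
          by (intro tendsto_ennrealI tendsto_powr2 tendsto_norm tendsto_diff tendsto_const) auto
        then show ?case by (rule lim_imp_Liminf[OF sequentially_bot, symmetric])
      qed
      also have "\<dots> \<le> liminf (\<lambda>k. Lp_mass M p (\<lambda>x. f n x - g k x))"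
        unfolding Lp_mass_def by (rule nn_integral_liminf) simp
      also have "\<dots> \<le> ennreal ((e/2) powr p)"
      proof (intro Liminf_le)
        have "\<forall>\<^sub>F k in sequentially. N \<le> k" by (rule eventually_ge_at_top)
        then show "\<forall>\<^sub>F k in sequentially. Lp_mass M p (\<lambda>x. f n x - g k x) \<le> ennreal ((e/2) powr p)"
        proof eventually_elim
          case (elim k)
          then have "N \<le> r k" using strict_mono_imp_increasing[OF \<open>strict_mono r\<close>] le_trans by blast
          then show ?case unfolding g_def using N[OF n] by (simp add: less_imp_le)
        qed
      qed simp
      also have "\<dots> < ennreal (e powr p)"
        using e p by (intro ennreal_lessI powr_less_mono2) auto
      finally show ?thesis .
    qed
    then show ?thesis by blast
  qed
  moreover have "G \<in> Lp_fun M p"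
  proof -
    obtain n where "Lp_mass M p (\<lambda>x. f n x - G x) < ennreal (1 powr p)"
      using close[of 1] by auto
    then have "(\<lambda>x. f n x - G x) \<in> Lp_fun M p"
      by (simp add: Lp_fun_iff) (metis ennreal_less_top less_trans ennreal_1)
    from Lp_fun_diff[OF p f[of n] this] show ?thesis by simp
  qed
  ultimately show ?thesis using that by blast
qed

theorem mcomplete_Lp:
  assumes p: "1 \<le> p"
  shows "Metric_space.mcomplete (Lp_space M p) (Lp_dist M p)"
proof -
  interpret L: Metric_space "Lp_space M p" "Lp_dist M p"
    by (rule Metric_space_Lp[OF p])
  show ?thesis
    unfolding L.mcomplete_def
  proof (intro allI impI)
    fix \<sigma> assume \<sigma>: "L.MCauchy \<sigma>"
    then have S: "\<sigma> n \<in> Lp_space M p" for n by (auto simp: L.MCauchy_def)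
    then have "\<forall>n. \<exists>f. f \<in> \<sigma> n \<and> f \<in> Lp_fun M p" by (meson Lp_space_rep)
    then obtain f where f: "\<And>n. f n \<in> \<sigma> n" "\<And>n. f n \<in> Lp_fun M p" by metis
    obtain G where G: "G \<in> Lp_fun M p"
      "\<And>e. 0 < e \<Longrightarrow> \<exists>N. \<forall>n\<ge>N. Lp_mass M p (\<lambda>x. f n x - G x) < ennreal (e powr p)"
    proof (rule Cauchy_Lp_limit[OF p f(2)])
      fix e :: real assume "0 < e"
      then show "\<exists>N. \<forall>m\<ge>N. \<forall>n\<ge>N. Lp_mass M p (\<lambda>x. f m x - f n x) < ennreal (e powr p)"
        using \<sigma> by (simp add: L.MCauchy_def Lp_dist_less_iff[OF p S S f(1) f(1)])
    qed blast
    let ?C = "Lp_rel M p `` {G}"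
    have C: "?C \<in> Lp_space M p" using G(1) by (auto simp: Lp_space_def quotientI)
    have GC: "G \<in> ?C" using G(1) by (simp add: Lp_rel_def)
    have "limitin L.mtopology \<sigma> ?C sequentially"
      unfolding L.limit_metric_sequentially
      using C S G(2) by (simp add: Lp_dist_less_iff[OF p S C f(1) GC])
    then show "\<exists>x. limitin L.mtopology \<sigma> x sequentially" by blast
  qed
qed

section \<open>The weighted half-line and translations\<close>

lemma space_bessel_measure [simp]: "space (bessel_measure l) = {0<..}"
  by (simp add: bessel_measure_def space_restrict_space)

lemma sets_bessel_measure [measurable_cong]:
  "sets (bessel_measure l) = sets (restrict_space borel {0<..})"
  by (simp add: bessel_measure_def sets_restrict_space)

lemma nn_integral_bessel_measure:
  assumes [measurable]: "g \<in> borel_measurable (bessel_measure l)"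
  shows "(\<integral>\<^sup>+x. g x \<partial>bessel_measure l) =
    (\<integral>\<^sup>+x\<in>{0<..}. g x * ennreal (x powr (2 * l)) \<partial>lborel)"
proof -
  have "g \<in> borel_measurable (restrict_space lborel {0<..})"
    using assms by (simp cong: measurable_cong_sets add: sets_bessel_measure sets_restrict_space)
  then show ?thesis
    unfolding bessel_measure_def
    by (subst nn_integral_density) (auto simp: nn_integral_restrict_space mult.commute mult.left_commute
        intro!: measurable_restrict_space1)
qed

lemma borel_measurable_bessel_ennreal:
  fixes g :: "real \<Rightarrow> ennreal"
  assumes "g \<in> borel_measurable (bessel_measure l)"
  shows "(\<lambda>x. g x * indicator {0<..} x) \<in> borel_measurable borel"
proof -
  have "g \<in> borel_measurable (restrict_space borel {0<..})"
    using assms by (simp cong: measurable_cong_sets add: sets_bessel_measure)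
  then show ?thesis
    by (simp add: borel_measurable_restrict_space_iff_ennreal)
qed

text \<open>A right translation maps the open half-line into itself. A left translation would expose
  values of a representative outside it, and these are arbitrary.\<close>

lemma measurable_bessel_shift [measurable]:
  assumes "0 \<le> y"
  shows "(\<lambda>x. x + y) \<in> bessel_measure l \<rightarrow>\<^sub>M bessel_measure l"
proof -
  have "(\<lambda>x. x + y) \<in> restrict_space borel {0<..} \<rightarrow>\<^sub>M restrict_space borel {0<..}"
    by (rule measurable_restrict_space3) (use assms in auto)
  then show ?thesis by (simp cong: measurable_cong_sets add: sets_bessel_measure)
qed

lemma borel_measurable_bessel_shift:
  assumes "0 \<le> y" "f \<in> borel_measurable (bessel_measure l)"
  shows "(\<lambda>x. f (x + y)) \<in> borel_measurable (bessel_measure l)"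
  using measurable_compose[OF measurable_bessel_shift[OF assms(1)] assms(2)] .

lemma borel_measurable_bessel_of_borel:
  "f \<in> borel_measurable borel \<Longrightarrow> f \<in> borel_measurable (bessel_measure l)"
  by (simp cong: measurable_cong_sets add: sets_bessel_measure measurable_restrict_space1)

text \<open>Translation invariance of Lebesgue measure, with \<open>c\<close> bounding the loss in
  the weight on \<open>A\<close>. The case \<open>c = 1\<close> on the whole line says that right
  translation is a contraction; a small \<open>c\<close> on an interval at the origin gives
  smallness there.\<close>

lemma nn_integral_bessel_shift_le:
  assumes y: "0 \<le> y" and g [measurable]: "g \<in> borel_measurable (bessel_measure l)"
    and [measurable]: "A \<in> sets borel"
    and w: "\<And>x. 0 < x \<Longrightarrow> x \<in> A \<Longrightarrow> x powr (2 * l) \<le> c * (x + y) powr (2 * l)" and c: "0 \<le> c"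
  shows "(\<integral>\<^sup>+x\<in>A. g (x + y) \<partial>bessel_measure l) \<le> ennreal c * (\<integral>\<^sup>+x. g x \<partial>bessel_measure l)"
proof -
  note [measurable] = borel_measurable_bessel_shift[OF y g]
    borel_measurable_bessel_of_borel[of "indicator A :: real \<Rightarrow> ennreal" l]
  let ?G = "\<lambda>x. g x * indicator {0<..} x * ennreal (x powr (2 * l))"
  have G [measurable]: "?G \<in> borel_measurable borel"
    using borel_measurable_bessel_ennreal[OF g] by measurable
  have "(\<integral>\<^sup>+x\<in>A. g (x + y) \<partial>bessel_measure l)
      = (\<integral>\<^sup>+x\<in>{0<..}. g (x + y) * indicator A x * ennreal (x powr (2 * l)) \<partial>lborel)"
    by (rule nn_integral_bessel_measure) measurable
  \<comment> \<open>The argument is written \<open>y + 1 * x\<close> to fit the affine substitution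
    rule.\<close>
  also have "\<dots> \<le> (\<integral>\<^sup>+x. ennreal c * ?G (y + 1 * x) \<partial>lborel)"
  proof (intro nn_integral_mono)
    fix x :: real
    show "g (x + y) * indicator A x * ennreal (x powr (2 * l)) * indicator {0<..} x
      \<le> ennreal c * ?G (y + 1 * x)"
    proof (cases "0 < x \<and> x \<in> A")
      case True
      then have "ennreal (x powr (2 * l)) \<le> ennreal c * ennreal ((x + y) powr (2 * l))"
        using w[of x] c by (simp flip: ennreal_mult add: ennreal_leI)
      then have "g (x + y) * ennreal (x powr (2 * l))
          \<le> g (x + y) * (ennreal c * ennreal ((x + y) powr (2 * l)))"
        by (intro mult_left_mono) auto
      then show ?thesis using True y by (simp add: ac_simps)
    qed auto
  qed
  also have "\<dots> = ennreal c * (\<integral>\<^sup>+x. ?G (y + 1 * x) \<partial>lborel)"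
    by (intro nn_integral_cmult) measurable
  also have "(\<integral>\<^sup>+x. ?G (y + 1 * x) \<partial>lborel) = (\<integral>\<^sup>+x. ?G x \<partial>lborel)"
    by (subst nn_integral_real_affine[OF G, of 1 y]) auto
  also have "\<dots> = (\<integral>\<^sup>+x. g x \<partial>bessel_measure l)"
    by (subst nn_integral_bessel_measure) (auto simp: ac_simps)
  finally show ?thesis .
qed

lemma Lp_mass_bessel_shift_le:
  assumes "0 \<le> l" "0 \<le> y" and [measurable]: "f \<in> borel_measurable (bessel_measure l)"
  shows "Lp_mass (bessel_measure l) p (\<lambda>x. f (x + y)) \<le> Lp_mass (bessel_measure l) p f"
  using nn_integral_bessel_shift_le[of y "\<lambda>x. ennreal (norm (f x) powr p)" l UNIV 1] assms
  by (simp add: Lp_mass_def powr_mono2)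

lemma bessel_tail_eq:
  assumes "0 < M" and [measurable]: "f \<in> borel_measurable (bessel_measure l)"
  shows "(\<integral>\<^sup>+x\<in>{M<..}. ennreal (norm (f x) powr p * x powr (2 * l)) \<partial>lborel)
    = (\<integral>\<^sup>+x\<in>{M<..}. ennreal (norm (f x) powr p) \<partial>bessel_measure l)"
proof -
  note [measurable] = borel_measurable_bessel_of_borel[of "indicator {M<..} :: real \<Rightarrow> ennreal" l]
  show ?thesis
    using \<open>0 < M\<close> by (subst nn_integral_bessel_measure)
      (auto intro!: nn_integral_cong simp: ennreal_mult split: split_indicator)
qed

lemma bessel_shift_mass_eq:
  assumes "0 \<le> y" and [measurable]: "f \<in> borel_measurable (bessel_measure l)"
  shows "(\<integral>\<^sup>+x\<in>{0<..}. ennreal (norm (f (x + y) - f x) powr p * x powr (2 * l)) \<partial>lborel)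
    = Lp_mass (bessel_measure l) p (\<lambda>x. f (x + y) - f x)"
proof -
  note [measurable] = borel_measurable_bessel_shift[OF assms]
  show ?thesis
    unfolding Lp_mass_def by (subst nn_integral_bessel_measure) (auto simp: ennreal_mult)
qed

section \<open>Sufficiency\<close>

text \<open>Near the origin the weight of a point is small compared with the weight of its translate by a
  fixed \<open>y\<close>, so \<open>f = (f - \<tau>\<^sub>y f) + \<tau>\<^sub>y f\<close> controls \<open>f\<close> there. This is where \<open>l > 0\<close> enters.\<close>

lemma bessel_mass_near_zero:
  assumes l: "0 \<le> l" and p: "0 \<le> p" and y: "0 < y" and h: "0 < h"
    and f [measurable]: "f \<in> borel_measurable (bessel_measure l)"
  shows "(\<integral>\<^sup>+x\<in>{..h}. ennreal (norm (f x) powr p) \<partial>bessel_measure l) \<le> ennreal (2 powr p) *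
    (Lp_mass (bessel_measure l) p (\<lambda>x. f (x + y) - f x) +
     ennreal ((h / y) powr (2 * l)) * Lp_mass (bessel_measure l) p f)"
proof -
  let ?N = "bessel_measure l"
  note [measurable] = borel_measurable_bessel_shift[OF less_imp_le[OF y] f]
    borel_measurable_bessel_of_borel[of "indicator {..h} :: real \<Rightarrow> ennreal" l]
  have "(\<integral>\<^sup>+x\<in>{..h}. ennreal (norm (f x) powr p) \<partial>?N) \<le> (\<integral>\<^sup>+x. ennreal (2 powr p) *
      (ennreal (norm (f (x + y) - f x) powr p) +
       ennreal (norm (f (x + y)) powr p) * indicator {..h} x) \<partial>?N)"
  proof (intro nn_integral_mono)
    fix x
    show "ennreal (norm (f x) powr p) * indicator {..h} x \<le> ennreal (2 powr p) *
      (ennreal (norm (f (x + y) - f x) powr p) + ennreal (norm (f (x + y)) powr p) * indicator {..h} x)"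
      using ennreal_norm_diff_powr_le[OF p, of "f x" 0 "f (x + y)"]
      by (simp add: norm_minus_commute split: split_indicator)
  qed
  also have "\<dots> = ennreal (2 powr p) * (Lp_mass ?N p (\<lambda>x. f (x + y) - f x) +
       (\<integral>\<^sup>+x\<in>{..h}. ennreal (norm (f (x + y)) powr p) \<partial>?N))"
    by (simp add: nn_integral_cmult nn_integral_add Lp_mass_def)
  also have "(\<integral>\<^sup>+x\<in>{..h}. ennreal (norm (f (x + y)) powr p) \<partial>?N)
      \<le> ennreal ((h / y) powr (2 * l)) * Lp_mass ?N p f"
    unfolding Lp_mass_def
  proof (rule nn_integral_bessel_shift_le)
    fix x :: real assume x: "0 < x" "x \<in> {..h}"
    \<comment> \<open>Since \<open>x \<le> h\<close>, one has
      \<open>x * y \<le> h * y \<le> h * (x + y)\<close>.\<close>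
    have "x \<le> h / y * (x + y)" using x h y by (simp add: field_simps add_increasing)
    then have "x powr (2 * l) \<le> (h / y * (x + y)) powr (2 * l)"
      using l x by (intro powr_mono2) auto
    also have "\<dots> = (h / y) powr (2 * l) * (x + y) powr (2 * l)"
      using x h y powr_mult[of "h / y" "x + y"] by simp
    finally show "x powr (2 * l) \<le> (h / y) powr (2 * l) * (x + y) powr (2 * l)" .
  qed (use y in auto)
  finally show ?thesis by (simp add: add_left_mono mult_left_mono)
qed

section \<open>Cells of the half-line and sampling inside them\<close>

text \<open>The ceiling makes the cells left-open and right-closed. The first is then exactly
  \<open>{0<..h}\<close>, its complement in the half-line is \<open>{h<..}\<close>, and offsets
  range over \<open>{0<..h}\<close>.\<close>

definition cell_start :: "real \<Rightarrow> real \<Rightarrow> real" where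
  "cell_start h x = h * (of_int \<lceil>x / h\<rceil> - 1)"

lemma cell_start_bounds:
  assumes "0 < h"
  shows "cell_start h x < x" "x \<le> cell_start h x + h"
proof -
  have "of_int \<lceil>x / h\<rceil> - 1 < x / h" "x / h \<le> of_int \<lceil>x / h\<rceil>" by linarith+
  from mult_strict_left_mono[OF this(1) assms] mult_left_mono[OF this(2) less_imp_le[OF assms]]
  show "cell_start h x < x" "x \<le> cell_start h x + h"
    using assms by (simp_all add: cell_start_def right_diff_distrib)
qed

text \<open>A cell starting at \<open>a \<ge> h\<close> ends at \<open>a + h \<le> 2 * a\<close>, so
  any two of its points differ at most by a factor 2. This is what bounds the ratio of weights
  within a cell.\<close>

lemma cell_start_ge:
  assumes "0 < h" "h < x"
  shows "h \<le> cell_start h x"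
proof -
  have "1 < x / h" using assms by (simp add: field_simps)
  then have "2 \<le> \<lceil>x / h\<rceil>" by linarith
  then have "(1::real) \<le> of_int \<lceil>x / h\<rceil> - 1" by linarith
  then show ?thesis using assms unfolding cell_start_def by (simp add: mult_left_mono)
qed

lemma cell_start_measurable [measurable]: "cell_start h \<in> borel_measurable borel"
  unfolding cell_start_def by measurable

text \<open>Averaging over \<open>t\<close> turns the sampling error into a double integral over pairs in a common cell.
  Pairs with the left point carrying the weight give the modulus of continuity directly. For the
  others the weight changes by at most the factor \<open>2 powr (2 * l)\<close>, since the first cell is left out.\<close>

lemma bessel_sampling:
  assumes l: "0 \<le> l" and h: "0 < h" and \<eta>: "0 < \<eta>"
    and f: "f \<in> borel_measurable (bessel_measure l)"
    and mod: "\<And>y. 0 < y \<Longrightarrow> y < h \<Longrightarrow> Lp_mass (bessel_measure l) p (\<lambda>x. f (x + y) - f x) \<le> ennreal \<eta>"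
  obtains t where "0 < t" "t \<le> h"
    "(\<integral>\<^sup>+x\<in>{h<..}. ennreal (norm (f x - f (cell_start h x + t)) powr p) \<partial>bessel_measure l)
      \<le> ennreal ((2 + 2 powr (2 * l)) * \<eta>)"
proof -
  \<comment> \<open>Extension by zero, since Tonelli on \<open>lborel\<close> needs a Borel function
    on the whole line and \<open>f\<close> is unconstrained off the half-line.\<close>
  define f0 where "f0 x = indicator {0<..} x *\<^sub>R f x" for x
  have [measurable]: "f0 \<in> borel_measurable borel"
  proof -
    have "f \<in> borel_measurable (restrict_space borel {0<..})"
      using f by (simp cong: measurable_cong_sets add: sets_bessel_measure)
    then show ?thesis
      by (simp add: borel_measurable_restrict_space_iff f0_def[abs_def])
  qed
  have f0: "f0 x = f x" if "0 < x" for x using that by (simp add: f0_def)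
  define k where "k x z = ennreal (norm (f0 x - f0 z) powr p)" for x z
  define W where "W x = ennreal (x powr (2 * l)) * indicator {0<..} x" for x :: real
  have [measurable]: "case_prod k \<in> borel_measurable (borel \<Otimes>\<^sub>M borel)"
    unfolding k_def by measurable
  have [measurable]: "W \<in> borel_measurable borel" unfolding W_def by measurable
  have k_sym: "k x z = k z x" for x z by (simp add: k_def norm_minus_commute)
  define C where "C = (2::real) powr (2 * l)"
  have C: "0 < C" by (simp add: C_def)
  \<comment> \<open>Both inequalities are strict: the kernel \<open>k\<close> vanishes on the
    diagonal, and \<open>mod\<close> covers only translations shorter than \<open>h\<close>. Two
    points of one left-open cell are always at distance less than \<open>h\<close>.\<close>
  define I :: "real \<Rightarrow> real \<Rightarrow> ennreal" where "I x z = (if x < z \<and> z < x + h then 1 else 0)" for x z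
  have [measurable]: "case_prod I \<in> borel_measurable (borel \<Otimes>\<^sub>M borel)"
    unfolding I_def by measurable
  define J where "J = (\<integral>\<^sup>+x. \<integral>\<^sup>+z. k x z * W x * I x z \<partial>lborel \<partial>lborel)"
  have J: "J \<le> ennreal (h * \<eta>)"
  proof -
    \<comment> \<open>Substituting \<open>z = x + y\<close> and exchanging the integrals makes
      \<open>J\<close> the integral over \<open>0 < y < h\<close> of the translation masses, each at
      most \<open>\<eta>\<close>.\<close>
    have "J = (\<integral>\<^sup>+x. \<integral>\<^sup>+y. k x (x + y) * W x * indicator {0<..<h} y \<partial>lborel \<partial>lborel)"
      unfolding J_def
    proof (rule nn_integral_cong)
      fix x
      show "(\<integral>\<^sup>+z. k x z * W x * I x z \<partial>lborel)
        = (\<integral>\<^sup>+y. k x (x + y) * W x * indicator {0<..<h} y \<partial>lborel)"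
        by (subst nn_integral_real_affine[where c = 1 and t = x])
          (auto intro!: nn_integral_cong simp: I_def split: split_indicator)
    qed
    also have "\<dots> = (\<integral>\<^sup>+y. \<integral>\<^sup>+x. k x (x + y) * W x * indicator {0<..<h} y \<partial>lborel \<partial>lborel)"
      by (rule lborel_pair.Fubini'[symmetric]) measurable
    also have "\<dots> \<le> (\<integral>\<^sup>+y. ennreal \<eta> * indicator {0<..<h} y \<partial>lborel)"
    proof (intro nn_integral_mono)
      fix y
      show "(\<integral>\<^sup>+x. k x (x + y) * W x * indicator {0<..<h} y \<partial>lborel) \<le> ennreal \<eta> * indicator {0<..<h} y"
      proof (cases "0 < y \<and> y < h")
        case True
        have "(\<integral>\<^sup>+x. k x (x + y) * W x \<partial>lborel)
            = (\<integral>\<^sup>+x\<in>{0<..}. ennreal (norm (f (x + y) - f x) powr p * x powr (2 * l)) \<partial>lborel)"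
          using True by (intro nn_integral_cong)
            (auto simp: k_def W_def f0 ennreal_mult norm_minus_commute split: split_indicator)
        also have "\<dots> \<le> ennreal \<eta>"
          using True f mod by (subst bessel_shift_mass_eq) auto
        finally show ?thesis using True by simp
      qed auto
    qed
    also have "\<dots> = ennreal (h * \<eta>)"
      using h \<eta> by (simp add: nn_integral_cmult_indicator ennreal_mult' mult.commute)
    finally show ?thesis .
  qed
  define G where "G t = (\<integral>\<^sup>+x. k x (cell_start h x + t) * indicator {h<..} x * W x \<partial>lborel)" for t
  have [measurable]: "G \<in> borel_measurable borel"
    unfolding G_def by measurable
  have "(\<integral>\<^sup>+t\<in>{0<..h}. G t \<partial>lborel)
      = (\<integral>\<^sup>+t. \<integral>\<^sup>+x. k x (cell_start h x + t) * indicator {h<..} x * W x * indicator {0<..h} t \<partial>lborel \<partial>lborel)"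
    unfolding G_def by (intro nn_integral_cong) (simp add: nn_integral_multc)
  also have "\<dots> = (\<integral>\<^sup>+x. \<integral>\<^sup>+t. k x (cell_start h x + t) * indicator {h<..} x * W x * indicator {0<..h} t \<partial>lborel \<partial>lborel)"
    by (rule lborel_pair.Fubini') measurable
  \<comment> \<open>For fixed \<open>x\<close>, the substitution
    \<open>z = cell_start h x + t\<close> turns the offsets into the points of the cell of
    \<open>x\<close>.\<close>
  also have "\<dots> = (\<integral>\<^sup>+x. \<integral>\<^sup>+z. k x z * indicator {h<..} x * W x *
      indicator {cell_start h x<..cell_start h x + h} z \<partial>lborel \<partial>lborel)"
  proof (rule nn_integral_cong)
    fix x
    show "(\<integral>\<^sup>+t. k x (cell_start h x + t) * indicator {h<..} x * W x * indicator {0<..h} t \<partial>lborel)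
      = (\<integral>\<^sup>+z. k x z * indicator {h<..} x * W x * indicator {cell_start h x<..cell_start h x + h} z \<partial>lborel)"
      by (subst (2) nn_integral_real_affine[where c = 1 and t = "cell_start h x"])
        (auto intro!: nn_integral_cong split: split_indicator)
  qed
  also have "\<dots> \<le> (\<integral>\<^sup>+x. \<integral>\<^sup>+z. k x z * W x * I x z
      + ennreal C * (k z x * W z * I z x) \<partial>lborel \<partial>lborel)"
  proof (intro nn_integral_mono)
    fix x z :: real
    let ?R = "k x z * W x * I x z + ennreal C * (k z x * W z * I z x)"
    show "k x z * indicator {h<..} x * W x * indicator {cell_start h x<..cell_start h x + h} z \<le> ?R"
    proof (cases "h < x \<and> cell_start h x < z \<and> z \<le> cell_start h x + h")
      case True
      note b = cell_start_bounds[OF h, of x] cell_start_ge[OF h, of x]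
      consider "x = z" | "x < z" | "z < x" by linarith
      then show ?thesis
      proof cases
        case 1
        then show ?thesis by (simp add: k_def)
      next
        case 2
        then have "I x z = 1" using True b by (auto simp: I_def)
        then show ?thesis using True by (simp add: add_increasing2)
      next
        case 3
        then have z: "I z x = 1" "0 < z" "x \<le> 2 * z" using True b h by (auto simp: I_def)
        have "x powr (2 * l) \<le> (2 * z) powr (2 * l)"
          using l z True h by (intro powr_mono2) auto
        then have "W x \<le> ennreal C * W z"
          using z True h by (simp add: W_def C_def powr_mult ennreal_leI flip: ennreal_mult)
        then have "k x z * W x \<le> k x z * (ennreal C * W z)"
          by (rule mult_left_mono) simp
        also have "\<dots> \<le> ?R"
          using z by (simp add: k_sym[of z x] ac_simps)
        finally show ?thesis using True by simp
      qed
    qed auto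
  qed
  also have "\<dots> = J + ennreal C * (\<integral>\<^sup>+x. \<integral>\<^sup>+z. k z x * W z * I z x \<partial>lborel \<partial>lborel)"
    unfolding J_def by (simp add: nn_integral_add nn_integral_cmult)
  also have "(\<integral>\<^sup>+x. \<integral>\<^sup>+z. k z x * W z * I z x \<partial>lborel \<partial>lborel) = J"
    unfolding J_def by (rule lborel_pair.Fubini') measurable
  also have "J + ennreal C * J \<le> ennreal (h * \<eta>) + ennreal C * ennreal (h * \<eta>)"
    by (intro add_mono mult_left_mono J) auto
  also have "\<dots> = ennreal (h * ((1 + C) * \<eta>))"
    using C h \<eta> by (simp flip: ennreal_mult ennreal_plus add: algebra_simps)
  finally have int: "(\<integral>\<^sup>+t\<in>{0<..h}. G t \<partial>lborel) \<le> ennreal (h * ((1 + C) * \<eta>))" .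
  \<comment> \<open>The mean of \<open>G\<close> over the offsets is at most
    \<open>(1 + C) * \<eta>\<close>. The spare \<open>\<eta>\<close> lets the contradiction come
    from weak inequalities between integrals.\<close>
  have "\<exists>t. 0 < t \<and> t \<le> h \<and> G t \<le> ennreal ((2 + C) * \<eta>)"
  proof (rule ccontr)
    assume less: "\<not> ?thesis"
    define Q where "Q = (2 + C) * \<eta>"
    have Q: "0 \<le> Q" using C \<eta> by (simp add: Q_def)
    from less have "(\<integral>\<^sup>+t. ennreal Q * indicator {0<..h} t \<partial>lborel) \<le> (\<integral>\<^sup>+t\<in>{0<..h}. G t \<partial>lborel)"
      unfolding Q_def by (intro nn_integral_mono) (auto split: split_indicator)
    also note int
    finally have "ennreal (h * Q) \<le> ennreal (h * ((1 + C) * \<eta>))"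
      using h Q by (simp add: nn_integral_cmult_indicator ennreal_mult mult.commute)
    then have "h * Q \<le> h * ((1 + C) * \<eta>)"
      using h \<eta> C by (subst (asm) ennreal_le_iff) auto
    then show False using h \<eta> by (simp add: Q_def algebra_simps)
  qed
  then obtain t where t: "0 < t" "t \<le> h" "G t \<le> ennreal ((2 + C) * \<eta>)" by blast
  let ?F = "\<lambda>x. ennreal (norm (f0 x - f0 (cell_start h x + t)) powr p) * indicator {h<..} x"
  have "(\<integral>\<^sup>+x\<in>{h<..}. ennreal (norm (f x - f (cell_start h x + t)) powr p) \<partial>bessel_measure l)
      = (\<integral>\<^sup>+x. ?F x \<partial>bessel_measure l)"
  proof (intro nn_integral_cong)
    fix x
    show "ennreal (norm (f x - f (cell_start h x + t)) powr p) * indicator {h<..} x = ?F x"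
    proof (cases "h < x")
      case True
      then have "0 < x" "0 < cell_start h x + t" using cell_start_ge[OF h True] h t by auto
      then show ?thesis by (simp add: f0)
    qed simp
  qed
  also have "\<dots> = (\<integral>\<^sup>+x\<in>{0<..}. ?F x * ennreal (x powr (2 * l)) \<partial>lborel)"
    by (intro nn_integral_bessel_measure borel_measurable_bessel_of_borel) measurable
  also have "\<dots> = G t"
    unfolding G_def k_def W_def by (intro nn_integral_cong) (auto split: split_indicator)
  finally show ?thesis using that[OF t(1,2)] t(3) by (simp add: C_def)
qed

section \<open>Size of the sampled values and the finite net\<close>

lemma bessel_emeasure_le:
  assumes "0 \<le> l" "0 \<le> L"
  shows "(\<integral>\<^sup>+x. indicator {..L} x \<partial>bessel_measure l) \<le> ennreal (L powr (2 * l) * L)"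
proof -
  note [measurable] = borel_measurable_bessel_of_borel[of "indicator {..L} :: real \<Rightarrow> ennreal" l]
  have "(\<integral>\<^sup>+x. indicator {..L} x \<partial>bessel_measure l)
      \<le> (\<integral>\<^sup>+x. ennreal (L powr (2 * l)) * indicator {0<..L} x \<partial>lborel)"
    using assms by (subst nn_integral_bessel_measure)
      (auto intro!: nn_integral_mono ennreal_leI powr_mono2 split: split_indicator)
  also have "\<dots> = ennreal (L powr (2 * l) * L)"
    using assms by (simp add: nn_integral_cmult_indicator ennreal_mult)
  finally show ?thesis .
qed

lemma bessel_emeasure_ge:
  assumes "0 \<le> l" "0 \<le> a" "0 \<le> h"
  shows "ennreal (a powr (2 * l) * h) \<le> (\<integral>\<^sup>+x. indicator {a<..a + h} x \<partial>bessel_measure l)"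
proof -
  note [measurable] = borel_measurable_bessel_of_borel[of "indicator {a<..a + h} :: real \<Rightarrow> ennreal" l]
  have "ennreal (a powr (2 * l) * h) = (\<integral>\<^sup>+x. ennreal (a powr (2 * l)) * indicator {a<..a + h} x \<partial>lborel)"
    using assms by (simp add: nn_integral_cmult_indicator ennreal_mult)
  also have "\<dots> \<le> (\<integral>\<^sup>+x. indicator {a<..a + h} x \<partial>bessel_measure l)"
    using assms by (subst nn_integral_bessel_measure)
      (auto intro!: nn_integral_mono ennreal_leI powr_mono2 split: split_indicator)
  finally show ?thesis .
qed

lemma cell_start_eq:
  assumes "0 < h" "h * of_int k < x" "x \<le> h * of_int k + h"
  shows "cell_start h x = h * of_int k"
proof -
  have "\<lceil>x / h\<rceil> = k + 1"
    using assms by (intro ceiling_unique) (auto simp: field_simps)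
  then show ?thesis by (simp add: cell_start_def)
qed

text \<open>The sampled value is constant on its cell, so its p-th power times the weight of the
  cell is at most \<open>2 powr p\<close> times the sampling error plus the mass of
  \<open>f\<close>. As \<open>k \<ge> 1\<close>, the cell lies beyond \<open>h\<close> and weighs at
  least \<open>h powr (2 * l) * h\<close>, which makes the bound independent of \<open>k\<close>,
  \<open>t\<close> and \<open>f\<close>.\<close>

lemma bessel_cell_value_bound:
  assumes l: "0 \<le> l" and p: "0 < p" and h: "0 < h" and k: "1 \<le> k" and b: "0 \<le> b"
    and f [measurable]: "f \<in> borel_measurable (bessel_measure l)"
    and B: "Lp_mass (bessel_measure l) p f \<le> ennreal B" "0 \<le> B"
    and s: "(\<integral>\<^sup>+x\<in>{h<..}. ennreal (norm (f x - f (cell_start h x + t)) powr p) \<partial>bessel_measure l)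
      \<le> ennreal b"
  shows "norm (f (h * of_int k + t)) \<le> (2 powr p * (b + B) / (h powr (2 * l) * h)) powr (1 / p)"
proof -
  let ?N = "bessel_measure l"
  define a where "a = h * of_int k"
  have a: "h \<le> a" using k h by (simp add: a_def mult_left_mono)
  define c where "c = f (a + t)"
  note [measurable] = borel_measurable_bessel_of_borel[of "indicator {h<..} :: real \<Rightarrow> ennreal" l]
    borel_measurable_bessel_of_borel[of "indicator {a<..a + h} :: real \<Rightarrow> ennreal" l]
  have "ennreal (norm c powr p) * ennreal (h powr (2 * l) * h)
      \<le> ennreal (norm c powr p) * ennreal (a powr (2 * l) * h)"
    using a h l by (intro mult_left_mono ennreal_leI mult_right_mono powr_mono2) auto
  also have "\<dots> \<le> ennreal (norm c powr p) * (\<integral>\<^sup>+x. indicator {a<..a + h} x \<partial>?N)"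
    using a h l by (intro mult_left_mono bessel_emeasure_ge) auto
  also have "\<dots> = (\<integral>\<^sup>+x. ennreal (norm c powr p) * indicator {a<..a + h} x \<partial>?N)"
    by (simp add: nn_integral_cmult)
  also have "\<dots> \<le> (\<integral>\<^sup>+x. ennreal (2 powr p) *
      (ennreal (norm (f x - c) powr p) * indicator {a<..a + h} x + ennreal (norm (f x) powr p)) \<partial>?N)"
  proof (intro nn_integral_mono)
    fix x
    show "ennreal (norm c powr p) * indicator {a<..a + h} x \<le> ennreal (2 powr p) *
      (ennreal (norm (f x - c) powr p) * indicator {a<..a + h} x + ennreal (norm (f x) powr p))"
      using ennreal_norm_diff_powr_le[of p c 0 "f x"] p
      by (simp add: norm_minus_commute split: split_indicator)
  qed
  also have "\<dots> = ennreal (2 powr p) *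
      ((\<integral>\<^sup>+x\<in>{a<..a + h}. ennreal (norm (f x - c) powr p) \<partial>?N) + Lp_mass ?N p f)"
    by (simp add: nn_integral_cmult nn_integral_add Lp_mass_def)
  also have "(\<integral>\<^sup>+x\<in>{a<..a + h}. ennreal (norm (f x - c) powr p) \<partial>?N)
      \<le> (\<integral>\<^sup>+x\<in>{h<..}. ennreal (norm (f x - f (cell_start h x + t)) powr p) \<partial>?N)"
  proof (intro nn_integral_mono)
    fix x
    show "ennreal (norm (f x - c) powr p) * indicator {a<..a + h} x
      \<le> ennreal (norm (f x - f (cell_start h x + t)) powr p) * indicator {h<..} x"
    proof (cases "a < x \<and> x \<le> a + h")
      case True
      then have "cell_start h x = a" unfolding a_def by (intro cell_start_eq[OF h]) auto
      then show ?thesis using True a by (simp add: c_def)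
    qed auto
  qed
  also note s
  also note B(1)
  finally have "ennreal (norm c powr p) * ennreal (h powr (2 * l) * h)
      \<le> ennreal (2 powr p) * (ennreal b + ennreal B)"
    by (simp add: mult_left_mono)
  then have "norm c powr p * (h powr (2 * l) * h) \<le> 2 powr p * (b + B)"
    using h b B by (simp flip: ennreal_mult ennreal_plus)
  then have "norm c powr p \<le> 2 powr p * (b + B) / (h powr (2 * l) * h)"
    using h by (simp add: field_simps)
  then have "(norm c powr p) powr (1 / p) \<le> (2 powr p * (b + B) / (h powr (2 * l) * h)) powr (1 / p)"
    using p by (intro powr_mono2) auto
  then show ?thesis using p by (simp add: powr_powr c_def a_def)
qed

text \<open>The mesh \<open>h\<close>, the cutoff \<open>L\<close> and the palette \<open>D\<close>
  of values are fixed before any \<open>f\<close> is chosen; only the offset and the choice of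
  palette values depend on \<open>f\<close>. The centres need not lie in \<open>H\<close>.\<close>

lemma bessel_finite_net:
  assumes l: "0 < l" and p: "0 < p"
    and H: "\<And>f. f \<in> H \<Longrightarrow> f \<in> borel_measurable (bessel_measure l)"
    and bound: "\<And>f. f \<in> H \<Longrightarrow> Lp_mass (bessel_measure l) p f \<le> ennreal B" and B: "0 \<le> B"
    and vanish: "\<And>e. 0 < e \<Longrightarrow> \<exists>M>0. \<forall>f\<in>H.
      (\<integral>\<^sup>+x\<in>{M<..}. ennreal (norm (f x) powr p) \<partial>bessel_measure l) \<le> ennreal e"
    and equi: "\<And>e. 0 < e \<Longrightarrow> \<exists>\<rho>>0. \<forall>f\<in>H. \<forall>y. 0 < y \<and> y < \<rho> \<longrightarrow>
      Lp_mass (bessel_measure l) p (\<lambda>x. f (x + y) - f x) \<le> ennreal e"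
    and \<epsilon>: "0 < \<epsilon>"
  obtains S where "finite S" "S \<subseteq> borel_measurable (bessel_measure l)"
    "\<And>f. f \<in> H \<Longrightarrow> \<exists>s\<in>S. Lp_mass (bessel_measure l) p (\<lambda>x. f x - s x) \<le> ennreal \<epsilon>"
proof -
  let ?N = "bessel_measure l"
  define K where "K = (2::real) powr p"
  define C where "C = 2 + (2::real) powr (2 * l)"
  have K: "0 < K" and C: "0 < C" by (auto simp: K_def C_def intro: add_pos_pos)
  \<comment> \<open>The summands of the denominator are the costs of the origin
    (\<open>2 * K\<close>), of the tail (\<open>1\<close>), and of sampling plus rounding
    (\<open>K * (C + 1)\<close>).\<close>
  define e where "e = \<epsilon> / (2 * K + 1 + K * (C + 1))"
  have D0: "0 < 2 * K + 1 + K * (C + 1)" using K C by (auto intro: add_pos_pos)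
  have e: "0 < e" and e_eq: "K * (2 * e) + e + K * (C * e + e) = \<epsilon>"
  proof -
    show "0 < e" using \<epsilon> D0 by (simp add: e_def)
    have "e * (2 * K + 1 + K * (C + 1)) = \<epsilon>" using D0 by (simp add: e_def)
    then show "K * (2 * e) + e + K * (C * e + e) = \<epsilon>" by (simp add: algebra_simps)
  qed
  obtain \<rho> where \<rho>: "0 < \<rho>" "\<And>f y. f \<in> H \<Longrightarrow> 0 < y \<Longrightarrow> y < \<rho> \<Longrightarrow>
      Lp_mass ?N p (\<lambda>x. f (x + y) - f x) \<le> ennreal e"
    using equi[OF e] by blast
  \<comment> \<open>One admissible translation, fixed for the estimate at the origin;
    \<open>h\<close> is then made small relative to it.\<close>
  define y where "y = \<rho> / 2"
  have y: "0 < y" "y < \<rho>" using \<rho> by (auto simp: y_def)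
  \<comment> \<open>The bound \<open>\<rho>\<close> makes every translation shorter than
    \<open>h\<close> admissible. The other entry solves
    \<open>(h / y) powr (2 * l) * (B + 1) = e\<close>; \<open>B + 1\<close> avoids dividing by
    zero.\<close>
  define h where "h = min \<rho> (y * (e / (B + 1)) powr (1 / (2 * l)))"
  have h: "0 < h" "h \<le> \<rho>" using \<rho> y e B by (auto simp: h_def)
  have hy: "(h / y) powr (2 * l) * B \<le> e"
  proof -
    have "h / y \<le> (e / (B + 1)) powr (1 / (2 * l))"
      using y by (simp add: h_def field_simps min_le_iff_disj)
    then have "(h / y) powr (2 * l) \<le> ((e / (B + 1)) powr (1 / (2 * l))) powr (2 * l)"
      using h y l by (intro powr_mono2) auto
    also have "\<dots> = e / (B + 1)" using l e B by (simp add: powr_powr)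
    finally have "(h / y) powr (2 * l) * B \<le> e / (B + 1) * B"
      using B by (rule mult_right_mono)
    also have "\<dots> \<le> e" using e B by (simp add: field_simps)
    finally show ?thesis .
  qed
  obtain M where M: "0 < M" "\<And>f. f \<in> H \<Longrightarrow>
      (\<integral>\<^sup>+x\<in>{M<..}. ennreal (norm (f x) powr p) \<partial>?N) \<le> ennreal e"
    using vanish[OF e] by blast
  \<comment> \<open>Cell number \<open>k\<close> is the interval from \<open>h * k\<close> to
    \<open>h * (k + 1)\<close>. The sampled cells are 1 to \<open>n\<close>, and \<open>L\<close> is
    the right end of the last one.\<close>
  define n where "n = \<lceil>M / h\<rceil>"
  define L where "L = h * of_int (n + 1)"
  have n: "0 \<le> n" using M h by (simp add: n_def) (smt (verit) divide_pos_pos)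
  have L: "0 < L" "M \<le> L"
  proof -
    show "0 < L" using n h by (simp add: L_def)
    have "M / h \<le> of_int (n + 1)" unfolding n_def by linarith
    then show "M \<le> L" using h by (simp add: L_def field_simps)
  qed
  \<comment> \<open>\<open>R\<close> bounds all sampled values, with \<open>C * e\<close> as the
    sampling error. \<open>V\<close> bounds the weight of \<open>{0<..L}\<close>, and
    \<open>\<zeta>\<close> is the rounding step whose total cost \<open>\<zeta> powr p * V\<close>
    is at most \<open>e\<close>.\<close>
  define R where "R = (2 powr p * (C * e + B) / (h powr (2 * l) * h)) powr (1 / p)"
  define V where "V = L powr (2 * l) * L"
  define \<zeta> where "\<zeta> = (e / (V + 1)) powr (1 / p)"
  have V: "0 \<le> V" using L by (simp add: V_def)
  have \<zeta>: "0 < \<zeta>" using e V by (simp add: \<zeta>_def)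
  have \<zeta>V: "\<zeta> powr p * V \<le> e"
  proof -
    have "\<zeta> powr p * V = e / (V + 1) * V" using p e V by (simp add: \<zeta>_def powr_powr)
    also have "\<dots> \<le> e" using e V by (simp add: field_simps)
    finally show ?thesis .
  qed
  \<comment> \<open>The trivial cover by balls around all points; compactness extracts the finite
    palette.\<close>
  have "cball 0 R \<subseteq> (\<Union>d\<in>UNIV. ball (d::complex) \<zeta>)"
    using \<zeta> by (auto intro: centre_in_ball[THEN iffD2])
  then obtain D :: "complex set" where D: "finite D" "cball 0 R \<subseteq> (\<Union>d\<in>D. ball d \<zeta>)"
    using compactE_image[OF compact_cball, of "UNIV :: complex set" "\<lambda>d. ball d \<zeta>" 0 R]
    by (metis open_ball)
  define st where "st d x = (if h < x \<and> x \<le> L then d (\<lceil>x / h\<rceil> - 1) else 0)"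
    for d :: "int \<Rightarrow> complex" and x :: real
  have st [measurable]: "st d \<in> borel_measurable ?N" for d
    by (rule borel_measurable_bessel_of_borel) (unfold st_def, measurable)
  show ?thesis
  proof (rule that)
    show "finite (st ` (Pi\<^sub>E {1..n} (\<lambda>_. D)))" using D(1) by (intro finite_imageI finite_PiE) auto
    show "st ` (Pi\<^sub>E {1..n} (\<lambda>_. D)) \<subseteq> borel_measurable ?N" using st by blast
    fix f assume f: "f \<in> H"
    note [measurable] = H[OF f]
    obtain t where t: "0 < t" "t \<le> h"
      "(\<integral>\<^sup>+x\<in>{h<..}. ennreal (norm (f x - f (cell_start h x + t)) powr p) \<partial>?N) \<le> ennreal (C * e)"
      unfolding C_def by (rule bessel_sampling[OF less_imp_le[OF l] h(1) e H[OF f]])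
        (use \<rho>(2)[OF f] h in auto)
    have val: "\<exists>d\<in>D. norm (f (h * of_int k + t) - d) < \<zeta>" if "k \<in> {1..n}" for k
    proof -
      have "norm (f (h * of_int k + t)) \<le> R"
        unfolding R_def using that l p h e C B t bound[OF f]
        by (intro bessel_cell_value_bound) auto
      then have "f (h * of_int k + t) \<in> cball 0 R" by simp
      then have "f (h * of_int k + t) \<in> (\<Union>d\<in>D. ball d \<zeta>)" using D(2) by blast
      then show ?thesis by (auto simp: dist_norm norm_minus_commute)
    qed
    \<comment> \<open>\<open>restrict\<close> makes the choice extensional, as membership in the
      finite set of functions \<open>Pi\<^sub>E\<close> requires.\<close>
    define d where "d = restrict (\<lambda>k. SOME d. d \<in> D \<and> norm (f (h * of_int k + t) - d) < \<zeta>) {1..n}"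
    have d: "d k \<in> D" "norm (f (h * of_int k + t) - d k) < \<zeta>" if "k \<in> {1..n}" for k
      using someI_ex[of "\<lambda>d. d \<in> D \<and> norm (f (h * of_int k + t) - d) < \<zeta>"] val[OF that] that
      by (auto simp: d_def)
    have dPi: "d \<in> Pi\<^sub>E {1..n} (\<lambda>_. D)" using d(1) by (auto simp: d_def)
    note [measurable] = borel_measurable_bessel_of_borel[of "indicator {..h} :: real \<Rightarrow> ennreal" l]
      borel_measurable_bessel_of_borel[of "indicator {M<..} :: real \<Rightarrow> ennreal" l]
      borel_measurable_bessel_of_borel[of "indicator {h<..} :: real \<Rightarrow> ennreal" l]
      borel_measurable_bessel_of_borel[of "indicator {..L} :: real \<Rightarrow> ennreal" l]
    define E where "E x = ennreal (norm (f x - f (cell_start h x + t)) powr p) * indicator {h<..} x" for x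
    have [measurable]: "E \<in> borel_measurable ?N"
    proof -
      \<comment> \<open>On the first cell the sampling point is replaced by \<open>1\<close>. Any
        positive number would do: the indicator in \<open>E\<close> vanishes there, and the map must
        stay in the half-line, where \<open>f\<close> is measurable.\<close>
      have shift: "(\<lambda>x. if h < x then cell_start h x + t else 1) \<in> ?N \<rightarrow>\<^sub>M ?N"
      proof -
        have "(\<lambda>x. if h < x then cell_start h x + t else 1)
            \<in> restrict_space borel {0<..} \<rightarrow>\<^sub>M restrict_space borel {0<..}"
        proof (rule measurable_restrict_space3)
          show "(\<lambda>x. if h < x then cell_start h x + t else 1) \<in> borel \<rightarrow>\<^sub>M borel" by measurable
          show "(\<lambda>x. if h < x then cell_start h x + t else 1) \<in> {0<..} \<rightarrow> {0<..}"
          proof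
            fix x
            show "(if h < x then cell_start h x + t else 1) \<in> {0<..}"
              using cell_start_ge[OF h(1), of x] h(1) t by auto
          qed
        qed
        then show ?thesis by (simp cong: measurable_cong_sets add: sets_bessel_measure)
      qed
      have [measurable]: "(\<lambda>x. f (if h < x then cell_start h x + t else 1)) \<in> borel_measurable ?N"
        by (rule measurable_compose[OF shift H[OF f]])
      have "E = (\<lambda>x. ennreal (norm (f x - f (if h < x then cell_start h x + t else 1)) powr p) * indicator {h<..} x)"
        by (auto simp: E_def fun_eq_iff split: split_indicator)
      also have "\<dots> \<in> borel_measurable ?N" by measurable
      finally show ?thesis .
    qed
    \<comment> \<open>The step function is zero on the first cell and beyond \<open>L\<close>, so
      \<open>f\<close> itself is the error there. The tail from \<open>M\<close> may overlap the
      sampled range, which only enlarges the bound.\<close>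
    have "Lp_mass ?N p (\<lambda>x. f x - st d x) \<le> (\<integral>\<^sup>+x. ennreal (norm (f x) powr p) * indicator {..h} x
        + ennreal (norm (f x) powr p) * indicator {M<..} x
        + ennreal K * (E x + ennreal (\<zeta> powr p) * indicator {..L} x) \<partial>?N)"
      unfolding Lp_mass_def
    proof (intro nn_integral_mono)
      fix x
      consider "x \<le> h" | "h < x" "L < x" | "h < x" "x \<le> L" by linarith
      then show "ennreal (norm (f x - st d x) powr p) \<le> ennreal (norm (f x) powr p) * indicator {..h} x
        + ennreal (norm (f x) powr p) * indicator {M<..} x
        + ennreal K * (E x + ennreal (\<zeta> powr p) * indicator {..L} x)"
      proof cases
        case 1
        then show ?thesis by (simp add: st_def add_increasing2)
      next
        case 2
        then have "M < x" using L by simp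
        then show ?thesis using 2 by (simp add: st_def add_increasing2)
      next
        case 3
        define k where "k = \<lceil>x / h\<rceil> - 1"
        have start: "cell_start h x = h * of_int k" by (simp add: k_def cell_start_def)
        have "k \<in> {1..n}"
        proof -
          have "1 < x / h" using 3 h by (simp add: field_simps)
          then have "1 \<le> k" unfolding k_def by linarith
          moreover have "x / h \<le> of_int (n + 1)" using 3 h by (simp add: L_def field_simps)
          then have "\<lceil>x / h\<rceil> \<le> n + 1" by (simp only: ceiling_le_iff)
          then have "k \<le> n" by (simp add: k_def)
          ultimately show ?thesis by simp
        qed
        then have "norm (f (cell_start h x + t) - d k) powr p \<le> \<zeta> powr p"
          using d(2)[of k] p unfolding start by (intro powr_mono2) auto
        then have "ennreal (norm (f x - d k) powr p) \<le> ennreal K *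
            (ennreal (norm (f x - f (cell_start h x + t)) powr p) + ennreal (\<zeta> powr p))"
          unfolding K_def using p
          by (intro order_trans[OF ennreal_norm_diff_powr_le[of p _ _ "f (cell_start h x + t)"]]
              mult_left_mono add_mono ennreal_leI) auto
        then show ?thesis using 3 by (simp add: st_def k_def E_def add_increasing)
      qed
    qed
    also have "\<dots> = (\<integral>\<^sup>+x\<in>{..h}. ennreal (norm (f x) powr p) \<partial>?N)
        + (\<integral>\<^sup>+x\<in>{M<..}. ennreal (norm (f x) powr p) \<partial>?N)
        + ennreal K * ((\<integral>\<^sup>+x. E x \<partial>?N) + ennreal (\<zeta> powr p) * (\<integral>\<^sup>+x. indicator {..L} x \<partial>?N))"
      by (simp add: nn_integral_add nn_integral_cmult)
    also have "\<dots> \<le> ennreal (K * (2 * e)) + ennreal e + ennreal K * (ennreal (C * e) + ennreal e)"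
    proof (intro add_mono mult_left_mono)
      have "(\<integral>\<^sup>+x\<in>{..h}. ennreal (norm (f x) powr p) \<partial>?N) \<le> ennreal (2 powr p) *
        (Lp_mass ?N p (\<lambda>x. f (x + y) - f x) + ennreal ((h / y) powr (2 * l)) * Lp_mass ?N p f)"
        using l p y h H[OF f] by (intro bessel_mass_near_zero) auto
      also have "\<dots> \<le> ennreal (2 powr p) * (ennreal e + ennreal ((h / y) powr (2 * l)) * ennreal B)"
        by (intro mult_left_mono add_mono \<rho>(2) f y bound) auto
      also have "\<dots> = ennreal (2 powr p * (e + (h / y) powr (2 * l) * B))"
        using e B by (simp add: ennreal_mult)
      also have "\<dots> \<le> ennreal (K * (2 * e))"
        unfolding K_def using hy by (intro ennreal_leI mult_left_mono) auto
      finally show "(\<integral>\<^sup>+x\<in>{..h}. ennreal (norm (f x) powr p) \<partial>?N) \<le> ennreal (K * (2 * e))" .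
      show "(\<integral>\<^sup>+x\<in>{M<..}. ennreal (norm (f x) powr p) \<partial>?N) \<le> ennreal e" by (rule M(2)[OF f])
      show "(\<integral>\<^sup>+x. E x \<partial>?N) \<le> ennreal (C * e)" unfolding E_def by (rule t(3))
      have "ennreal (\<zeta> powr p) * (\<integral>\<^sup>+x. indicator {..L} x \<partial>?N) \<le> ennreal (\<zeta> powr p) * ennreal V"
        unfolding V_def using l L by (intro mult_left_mono bessel_emeasure_le) auto
      also have "\<dots> \<le> ennreal e" using \<zeta>V V by (simp flip: ennreal_mult add: ennreal_leI)
      finally show "ennreal (\<zeta> powr p) * (\<integral>\<^sup>+x. indicator {..L} x \<partial>?N) \<le> ennreal e" .
    qed simp
    also have "\<dots> = ennreal \<epsilon>"
      using K C e e_eq by (simp flip: ennreal_mult ennreal_plus)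
    finally show "\<exists>s\<in>st ` (Pi\<^sub>E {1..n} (\<lambda>_. D)). Lp_mass ?N p (\<lambda>x. f x - s x) \<le> ennreal \<epsilon>"
      using dPi by blast
  qed
qed

section \<open>Necessity\<close>

text \<open>Dominated convergence along integer cutoffs; monotonicity of the tail in
  \<open>M\<close> extends this to real cutoffs.\<close>

lemma bessel_tail_tendsto:
  assumes f: "f \<in> Lp_fun (bessel_measure l) p" and e: "0 < e"
  shows "\<forall>\<^sub>F M in at_top. (\<integral>\<^sup>+x\<in>{M<..}. ennreal (norm (f x) powr p) \<partial>bessel_measure l) < ennreal e"
proof -
  let ?N = "bessel_measure l"
  note [measurable] = f[THEN Lp_funD]
    borel_measurable_bessel_of_borel[of "indicator {M<..} :: real \<Rightarrow> ennreal" l for M]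
  have "(\<lambda>n. \<integral>\<^sup>+x\<in>{real n<..}. ennreal (norm (f x) powr p) \<partial>?N) \<longlonglongrightarrow> (\<integral>\<^sup>+x. 0 \<partial>?N)"
  proof (rule nn_integral_dominated_convergence)
    show "(\<integral>\<^sup>+x. ennreal (norm (f x) powr p) \<partial>?N) < \<infinity>"
      using f by (simp add: Lp_fun_iff Lp_mass_def)
    show "AE x in ?N. (\<lambda>n. ennreal (norm (f x) powr p) * indicator {real n<..} x) \<longlonglongrightarrow> 0"
    proof (rule AE_I2)
      fix x :: real
      obtain n0 where "x \<le> real n0" using real_arch_simple by blast
      then have "\<forall>\<^sub>F n in sequentially. ennreal (norm (f x) powr p) * indicator {real n<..} x = 0"
        by (intro eventually_sequentiallyI[of n0]) (auto simp: indicator_def)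
      then show "(\<lambda>n. ennreal (norm (f x) powr p) * indicator {real n<..} x) \<longlonglongrightarrow> 0"
        by (rule tendsto_eventually)
    qed
  qed (auto split: split_indicator)
  then have "\<forall>\<^sub>F n in sequentially. (\<integral>\<^sup>+x\<in>{real n<..}. ennreal (norm (f x) powr p) \<partial>?N) < ennreal e"
    using e by (intro order_tendstoD(2)) auto
  then obtain n where n: "(\<integral>\<^sup>+x\<in>{real n<..}. ennreal (norm (f x) powr p) \<partial>?N) < ennreal e"
    by (auto simp: eventually_sequentially)
  have "(\<integral>\<^sup>+x\<in>{M<..}. ennreal (norm (f x) powr p) \<partial>?N)
      \<le> (\<integral>\<^sup>+x\<in>{real n<..}. ennreal (norm (f x) powr p) \<partial>?N)" if "real n \<le> M" for M
    using that by (intro nn_integral_mono) (auto split: split_indicator)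
  then show ?thesis
    using n unfolding eventually_at_top_linorder by (blast intro: le_less_trans)
qed

section \<open>Continuity of translation in the weighted space\<close>

text \<open>By regularity \<open>A\<close> is squeezed between a compact \<open>K\<close> and an open \<open>U\<close> with \<open>U - K\<close> small. A
  translation by less than the distance of \<open>K\<close> to the complement of \<open>U\<close> can change membership in
  \<open>A\<close> only at points that lie in \<open>U - K\<close> before or after the translation.\<close>

lemma bessel_indicator_shift:
  assumes l: "0 \<le> l" and A: "A \<in> sets borel" "A \<subseteq> {0<..m}" and e: "0 < e"
  shows "\<forall>\<^sub>F y in at_right 0.
    (\<integral>\<^sup>+x. indicator {x. (x \<in> A) \<noteq> (x + y \<in> A)} x \<partial>bessel_measure l) \<le> ennreal e"
proof (cases "A = {}")
  case True
  then show ?thesis by simp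
next
  case False
  then have m: "0 < m" using A by force
  let ?N = "bessel_measure l"
  \<comment> \<open>Cutting the weight off at \<open>m + 1\<close> gives a finite measure, to which
    regularity applies, and leaves room for translates of points of \<open>A\<close> by less than
    1.\<close>
  define \<mu> where "\<mu> = density lborel (\<lambda>x. ennreal (x powr (2 * l)) * indicator {0<..m + 1} x)"
  have sets_\<mu>: "sets \<mu> = sets borel" by (simp add: \<mu>_def)
  have \<mu>_eq: "emeasure \<mu> B = (\<integral>\<^sup>+x. indicator B x \<partial>?N)" if B: "B \<in> sets borel" "B \<subseteq> {0<..m + 1}" for B
  proof -
    note [measurable] = B(1) borel_measurable_bessel_of_borel[of "indicator B :: real \<Rightarrow> ennreal" l]
    show ?thesis
      unfolding \<mu>_def using B by (subst emeasure_density, (measurable)[2], subst nn_integral_bessel_measure)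
        (auto intro!: nn_integral_cong split: split_indicator)
  qed
  have fin: "emeasure \<mu> (space \<mu>) < \<infinity>"
  proof -
    have "emeasure \<mu> (space \<mu>) = (\<integral>\<^sup>+x. ennreal (x powr (2 * l)) * indicator {0<..m + 1} x \<partial>lborel)"
      unfolding \<mu>_def by (subst emeasure_density) auto
    also have "\<dots> \<le> (\<integral>\<^sup>+x. ennreal ((m + 1) powr (2 * l)) * indicator {0<..m + 1} x \<partial>lborel)"
      using l by (intro nn_integral_mono) (auto intro!: ennreal_leI powr_mono2 split: split_indicator)
    also have "\<dots> < \<infinity>"
      using m by (simp add: nn_integral_cmult_indicator ennreal_mult_less_top)
    finally show ?thesis .
  qed
  interpret \<mu>: finite_measure \<mu> by (rule finite_measureI) (use fin in auto)
  \<comment> \<open>\<open>U - K\<close> costs \<open>2 * e'\<close> and is counted twice, at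
    \<open>x\<close> and at \<open>x + y\<close>.\<close>
  define e' where "e' = e / 4"
  have e': "0 < e'" using e by (simp add: e'_def)
  obtain K where K: "K \<subseteq> A" "compact K" "emeasure \<mu> A < emeasure \<mu> K + ennreal e'"
  proof -
    have "\<exists>K\<in>{K. K \<subseteq> A \<and> compact K}. emeasure \<mu> A < emeasure \<mu> K + ennreal e'"
      by (rule SUP_approx_ennreal[OF _ _ inner_regular[OF sets_\<mu> _ A(1)]]) (use e' fin in auto)
    then show ?thesis using that by blast
  qed
  obtain U where U: "A \<subseteq> U" "open U" "emeasure \<mu> U < emeasure \<mu> A + ennreal e'"
  proof -
    have "\<exists>U\<in>{U. A \<subseteq> U \<and> open U}. emeasure \<mu> U < emeasure \<mu> A + ennreal e'"
      by (rule INF_approx_ennreal[OF _ outer_regular[OF sets_\<mu> _ A(1)]]) (use e' fin in auto)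
    then show ?thesis using that by blast
  qed
  have Kb [measurable]: "K \<in> sets borel" using K(2) by (simp add: borel_compact)
  have Ub [measurable]: "U \<in> sets borel" using U(2) by simp
  note [measurable] = A(1)
  define D where "D = (U - K) \<inter> {0<..m + 1}"
  have D [measurable]: "D \<in> sets borel" by (simp add: D_def)
  have D_small: "(\<integral>\<^sup>+x. indicator D x \<partial>?N) \<le> ennreal (2 * e')"
  proof -
    have "(\<integral>\<^sup>+x. indicator D x \<partial>?N) = emeasure \<mu> D" by (rule \<mu>_eq[symmetric]) (auto simp: D_def)
    also have "\<dots> \<le> emeasure \<mu> (U - K)" by (intro emeasure_mono) (auto simp: D_def sets_\<mu>)
    also have "\<dots> = ennreal (measure \<mu> U - measure \<mu> K)"
      using K(1) U(1) by (subst \<mu>.emeasure_eq_measure, subst \<mu>.finite_measure_Diff) (auto simp: sets_\<mu>)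
    also have "\<dots> \<le> ennreal (2 * e')"
    proof (rule ennreal_leI)
      have "measure \<mu> A < measure \<mu> K + e'" "measure \<mu> U < measure \<mu> A + e'"
        using K(3) U(3) e' by (auto simp: \<mu>.emeasure_eq_measure ennreal_less_iff simp flip: ennreal_plus)
      then show "measure \<mu> U - measure \<mu> K \<le> 2 * e'" by linarith
    qed
    finally show ?thesis .
  qed
  obtain \<delta> where \<delta>: "0 < \<delta>" "\<And>x y. x \<in> K \<Longrightarrow> y \<notin> U \<Longrightarrow> \<delta> \<le> dist x y"
    using separate_compact_closed[of K "- U"] K(1,2) U(1,2) by blast
  have small: "(\<integral>\<^sup>+x. indicator {x. (x \<in> A) \<noteq> (x + y \<in> A)} x \<partial>?N) \<le> ennreal e"
    if y: "0 < y" "y < min \<delta> 1" for y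
  proof -
    have Dm: "(indicator D :: real \<Rightarrow> ennreal) \<in> borel_measurable ?N"
      by (rule borel_measurable_bessel_of_borel) measurable
    have Dym: "(\<lambda>x. indicator D (x + y) :: ennreal) \<in> borel_measurable ?N"
      by (rule borel_measurable_bessel_shift[OF less_imp_le[OF y(1)] Dm])
    have "(\<integral>\<^sup>+x. indicator {x. (x \<in> A) \<noteq> (x + y \<in> A)} x \<partial>?N)
        \<le> (\<integral>\<^sup>+x. indicator D x + indicator D (x + y) \<partial>?N)"
    proof (intro nn_integral_mono)
      fix x assume "x \<in> space ?N"
      then have x: "0 < x" by simp
      have memb: "x \<in> D \<or> x + y \<in> D" if ne: "(x \<in> A) \<noteq> (x + y \<in> A)"
      proof (cases "x \<in> A")
        case True
        then have xA: "x \<le> m" "x + y \<notin> A" using A(2) ne by auto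
        show ?thesis
        proof (cases "x \<in> K")
          case True
          then have "x + y \<in> U" using \<delta>(2)[of x "x + y"] y by (auto simp: dist_norm)
          then show ?thesis using xA x y K(1) by (auto simp: D_def)
        next
          case False
          then show ?thesis using True xA x U(1) by (auto simp: D_def)
        qed
      next
        case False
        then have xA: "x + y \<in> A" "x + y \<le> m" using A(2) ne by auto
        show ?thesis
        proof (cases "x + y \<in> K")
          case True
          then have "x \<in> U" using \<delta>(2)[of "x + y" x] y by (auto simp: dist_norm)
          then show ?thesis using xA False x y K(1) by (auto simp: D_def)
        next
          case nK: False
          then show ?thesis using xA x y U(1) by (auto simp: D_def)
        qed
      qed
      show "indicator {x. (x \<in> A) \<noteq> (x + y \<in> A)} x \<le> (indicator D x + indicator D (x + y) :: ennreal)"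
      proof (cases "(x \<in> A) \<noteq> (x + y \<in> A)")
        case True
        have "1 \<le> (indicator D x + indicator D (x + y) :: ennreal)"
          using memb[OF True] by (rule disjE) (simp_all add: add_increasing add_increasing2)
        moreover have "indicator B x \<le> (1 :: ennreal)" for B by (simp add: indicator_def)
        ultimately show ?thesis by (rule order_trans[rotated])
      next
        case False
        then have "x \<notin> {x. (x \<in> A) \<noteq> (x + y \<in> A)}" by (simp only: mem_Collect_eq not_False_eq_True)
        then show ?thesis unfolding indicator_simps(2)[OF \<open>x \<notin> _\<close>] by simp
      qed
    qed
    also have "\<dots> = (\<integral>\<^sup>+x. indicator D x \<partial>?N) + (\<integral>\<^sup>+x. indicator D (x + y) \<partial>?N)"
      by (rule nn_integral_add[OF Dm Dym])
    also have "(\<integral>\<^sup>+x. indicator D (x + y) \<partial>?N) \<le> (\<integral>\<^sup>+x. indicator D x \<partial>?N)"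
    proof -
      have "(\<integral>\<^sup>+x\<in>UNIV. indicator D (x + y) \<partial>?N) \<le> ennreal 1 * (\<integral>\<^sup>+x. indicator D x \<partial>?N)"
      proof (rule nn_integral_bessel_shift_le)
        show "x powr (2 * l) \<le> 1 * (x + y) powr (2 * l)" if "0 < x" for x
          using that l y(1) by (simp add: powr_mono2)
      qed (use y(1) Dm in simp_all)
      then show ?thesis by (simp only: indicator_UNIV mult_1_right ennreal_1 mult_1)
    qed
    also have "(\<integral>\<^sup>+x. indicator D x \<partial>?N) + (\<integral>\<^sup>+x. indicator D x \<partial>?N) \<le> ennreal (2 * e') + ennreal (2 * e')"
      by (intro add_mono D_small)
    also have "\<dots> = ennreal e" using e by (simp add: e'_def flip: ennreal_plus)
    finally show ?thesis by (simp add: add_left_mono)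
  qed
  show ?thesis
    unfolding eventually_at_right_field
  proof (intro exI conjI allI impI)
    show "0 < min \<delta> 1" using \<delta>(1) by simp
  qed (rule small)
qed

text \<open>Where a translation changes the value of \<open>g\<close>, the point has entered or left
  a level set of a nonzero value. These level sets are finitely many and bounded, and the jump is at
  most twice the supremum of \<open>norm (g x)\<close>.\<close>

lemma bessel_finite_range_shift:
  fixes g :: "real \<Rightarrow> complex"
  assumes l: "0 \<le> l" and p: "0 \<le> p" and g [measurable]: "g \<in> borel_measurable borel"
    and fin: "finite (range g)" and supp: "\<And>x. x \<notin> {0<..m} \<Longrightarrow> g x = 0" and e: "0 < e"
  shows "\<forall>\<^sub>F y in at_right 0. Lp_mass (bessel_measure l) p (\<lambda>x. g (x + y) - g x) \<le> ennreal e"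
proof -
  let ?N = "bessel_measure l"
  define S where "S = range g - {0}"
  define A where "A c = g -` {c}" for c
  have S: "finite S" using fin by (simp add: S_def)
  have A [measurable]: "A c \<in> sets borel" for c
    using measurable_sets[OF g, of "{c}"] by (simp add: A_def)
  have A_sub: "A c \<subseteq> {0<..m}" if "c \<in> S" for c
  proof
    fix x assume "x \<in> A c"
    then have "g x \<noteq> 0" using that by (auto simp: A_def S_def)
    then show "x \<in> {0<..m}" using supp[of x] by blast
  qed
  obtain b where b: "0 < b" "\<And>x. norm (g x) \<le> b"
    using finite_imp_bounded[OF fin] by (auto simp: bounded_pos)
  define Q where "Q = (2 * b) powr p"
  have Q: "0 < Q" using b by (simp add: Q_def)
  define e' where "e' = e / (Q * (real (card S) + 1))"
  have e': "0 < e'" using e Q by (simp add: e'_def)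
  have "\<forall>\<^sub>F y in at_right 0. \<forall>c\<in>S. (\<integral>\<^sup>+x. indicator {x. (x \<in> A c) \<noteq> (x + y \<in> A c)} x \<partial>?N) \<le> ennreal e'"
    by (intro eventually_ball_finite S ballI bessel_indicator_shift[OF l A A_sub e'])
  then show ?thesis
  proof eventually_elim
    case (elim y)
    have "Lp_mass ?N p (\<lambda>x. g (x + y) - g x) \<le> (\<integral>\<^sup>+x. ennreal Q *
        (\<Sum>c\<in>S. indicator {x. (x \<in> A c) \<noteq> (x + y \<in> A c)} x) \<partial>?N)"
      unfolding Lp_mass_def
    proof (intro nn_integral_mono)
      fix x
      let ?sum = "\<Sum>c\<in>S. indicator {x. (x \<in> A c) \<noteq> (x + y \<in> A c)} x :: ennreal"
      show "ennreal (norm (g (x + y) - g x) powr p) \<le> ennreal Q * ?sum"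
      proof (cases "g (x + y) = g x")
        case False
        \<comment> \<open>One of the two values is nonzero, and its level set contains exactly one
          of the two points.\<close>
        then obtain c where c: "c \<in> S" "(x \<in> A c) \<noteq> (x + y \<in> A c)"
          by (cases "g x = 0") (auto simp: S_def A_def)
        have "indicator {x. (x \<in> A c) \<noteq> (x + y \<in> A c)} x \<le> ?sum"
          using S c(1) by (intro member_le_sum) auto
        then have one: "1 \<le> ?sum" using c(2) by (simp add: indicator_def split: if_splits)
        have "norm (g (x + y) - g x) \<le> 2 * b"
          using b(2)[of x] b(2)[of "x + y"] norm_triangle_ineq4[of "g (x + y)" "g x"] by linarith
        then have "ennreal (norm (g (x + y) - g x) powr p) \<le> ennreal Q * 1"
          unfolding Q_def using p by (simp add: ennreal_leI powr_mono2)
        also have "\<dots> \<le> ennreal Q * ?sum" by (rule mult_left_mono[OF one]) simp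
        finally show ?thesis .
      qed simp
    qed
    also have "\<dots> = ennreal Q * (\<Sum>c\<in>S. \<integral>\<^sup>+x. indicator {x. (x \<in> A c) \<noteq> (x + y \<in> A c)} x \<partial>?N)"
    proof -
      define T :: "complex \<Rightarrow> real \<Rightarrow> ennreal" where "T c = indicator {x. (x \<in> A c) \<noteq> (x + y \<in> A c)}" for c
      have "T c \<in> borel_measurable ?N" for c
        unfolding T_def by (rule borel_measurable_bessel_of_borel) measurable
      then have "(\<integral>\<^sup>+x. ennreal Q * (\<Sum>c\<in>S. T c x) \<partial>?N) = ennreal Q * (\<Sum>c\<in>S. \<integral>\<^sup>+x. T c x \<partial>?N)"
        by (simp add: nn_integral_cmult nn_integral_sum)
      then show ?thesis by (simp only: T_def)
    qed
    also have "\<dots> \<le> ennreal Q * (\<Sum>c\<in>S. ennreal e')"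
      using elim by (intro mult_left_mono sum_mono) auto
    also have "\<dots> = ennreal (Q * (real (card S) * e'))"
      using Q e' by (simp add: ennreal_mult ennreal_of_nat_eq_real_of_nat)
    also have "\<dots> \<le> ennreal e"
    proof (rule ennreal_leI)
      have "Q * ((real (card S) + 1) * e') = e" using Q by (simp add: e'_def)
      moreover have "Q * (real (card S) * e') \<le> Q * ((real (card S) + 1) * e')"
        using Q e' by (intro mult_left_mono mult_right_mono) auto
      ultimately show "Q * (real (card S) * e') \<le> e" by simp
    qed
    finally show ?case .
  qed
qed

text \<open>Simple functions converging pointwise with norm at most \<open>2 * norm (f x)\<close>
  are cut off to \<open>{0<..real i}\<close>. The cutoff is eventually inactive at each point, so
  dominated convergence applies.\<close>

lemma bessel_finite_range_dense:
  assumes p: "0 < p" and f: "f \<in> Lp_fun (bessel_measure l) p" and e: "0 < e"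
  obtains g m where "g \<in> borel_measurable borel" "finite (range g)"
    "\<And>x. x \<notin> {0<..m} \<Longrightarrow> g x = 0" "Lp_mass (bessel_measure l) p (\<lambda>x. f x - g x) < ennreal e"
proof -
  let ?N = "bessel_measure l"
  note fm [measurable] = f[THEN Lp_funD]
  define f0 where "f0 x = indicator {0<..} x *\<^sub>R f x" for x
  have f0m: "f0 \<in> borel_measurable borel"
  proof -
    have "f \<in> borel_measurable (restrict_space borel {0<..})"
      using fm by (simp cong: measurable_cong_sets add: sets_bessel_measure)
    then show ?thesis
      by (simp add: borel_measurable_restrict_space_iff f0_def[abs_def])
  qed
  obtain s where s: "\<And>i. simple_function borel (s i)" "\<And>x. (\<lambda>i. s i x) \<longlonglongrightarrow> f0 x"
    "\<And>i x. norm (s i x) \<le> 2 * norm (f0 x)"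
    using borel_measurable_implies_sequence_metric[OF f0m, of 0] by auto
  define g where "g i x = (if x \<in> {0<..real i} then s i x else 0)" for i x
  have [measurable]: "s i \<in> borel_measurable borel" for i
    using s(1) by (rule borel_measurable_simple_function)
  have g [measurable]: "g i \<in> borel_measurable borel" for i
    unfolding g_def by measurable
  note [measurable] = borel_measurable_bessel_of_borel[OF g, where l = l]
  have "(\<lambda>i. Lp_mass ?N p (\<lambda>x. f x - g i x)) \<longlonglongrightarrow> (\<integral>\<^sup>+x. 0 \<partial>?N)"
    unfolding Lp_mass_def
  \<comment> \<open>The \<open>3\<close> is one copy of \<open>norm (f x)\<close> plus the factor 2
    bounding the approximants.\<close>
  proof (rule nn_integral_dominated_convergence[where w = "\<lambda>x. ennreal (3 powr p) * ennreal (norm (f x) powr p)"])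
    show "(\<integral>\<^sup>+x. ennreal (3 powr p) * ennreal (norm (f x) powr p) \<partial>?N) < \<infinity>"
      using f by (simp add: nn_integral_cmult Lp_fun_iff Lp_mass_def ennreal_mult_less_top)
    show "AE x in ?N. ennreal (norm (f x - g i x) powr p) \<le> ennreal (3 powr p) * ennreal (norm (f x) powr p)" for i
    proof (rule AE_I2)
      fix x assume "x \<in> space ?N"
      then have "norm (g i x) \<le> 2 * norm (f x)"
        using s(3)[of i x] by (simp add: g_def f0_def)
      then have "norm (f x - g i x) \<le> 3 * norm (f x)"
        using norm_triangle_ineq4[of "f x" "g i x"] by linarith
      then have "norm (f x - g i x) powr p \<le> (3 * norm (f x)) powr p"
        using p by (intro powr_mono2) auto
      then show "ennreal (norm (f x - g i x) powr p) \<le> ennreal (3 powr p) * ennreal (norm (f x) powr p)"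
        by (simp add: powr_mult ennreal_leI flip: ennreal_mult)
    qed
    show "AE x in ?N. (\<lambda>i. ennreal (norm (f x - g i x) powr p)) \<longlonglongrightarrow> 0"
    proof (rule AE_I2)
      fix x assume "x \<in> space ?N"
      then have x: "0 < x" by simp
      obtain n0 where "x \<le> real n0" using real_arch_simple by blast
      then have "\<forall>\<^sub>F i in sequentially. s i x = g i x"
        using x by (intro eventually_sequentiallyI[of n0]) (auto simp: g_def)
      then have "(\<lambda>i. g i x) \<longlonglongrightarrow> f x"
        using s(2)[of x] x by (simp add: f0_def filterlim_cong)
      then have "(\<lambda>i. ennreal (norm (f x - g i x) powr p)) \<longlonglongrightarrow> ennreal (norm (f x - f x) powr p)"
        using p by (intro tendsto_ennrealI tendsto_powr2 tendsto_norm tendsto_diff tendsto_const) auto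
      then show "(\<lambda>i. ennreal (norm (f x - g i x) powr p)) \<longlonglongrightarrow> 0" by simp
    qed
  qed auto
  then have "\<forall>\<^sub>F i in sequentially. Lp_mass ?N p (\<lambda>x. f x - g i x) < ennreal e"
    using e by (intro order_tendstoD(2)) auto
  then obtain i where "Lp_mass ?N p (\<lambda>x. f x - g i x) < ennreal e"
    by (auto simp: eventually_sequentially)
  moreover have "finite (range (g i))"
  proof (rule finite_subset)
    show "range (g i) \<subseteq> insert 0 (range (s i))" by (auto simp: g_def)
    show "finite (insert 0 (range (s i)))" using simple_functionD(1)[OF s(1)[of i]] by simp
  qed
  ultimately show ?thesis
    by (intro that[of "g i" "real i", OF g]) (auto simp: g_def)
qed

text \<open>Split through \<open>g (x + y)\<close> and then \<open>g x\<close>. The translated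
  difference \<open>f - g\<close> has no more mass than \<open>f - g\<close>, and the two splittings
  nest the factors \<open>2 powr p\<close>. It serves both for the density argument and for passing
  from a net to the whole family.\<close>

lemma bessel_shift_mass_perturb:
  assumes l: "0 \<le> l" and p: "0 \<le> p" and y: "0 \<le> y"
    and f: "f \<in> borel_measurable (bessel_measure l)"
    and g: "g \<in> borel_measurable (bessel_measure l)"
    and fg: "Lp_mass (bessel_measure l) p (\<lambda>x. f x - g x) \<le> ennreal a"
    and gg: "Lp_mass (bessel_measure l) p (\<lambda>x. g (x + y) - g x) \<le> ennreal a" and a: "0 \<le> a"
  shows "Lp_mass (bessel_measure l) p (\<lambda>x. f (x + y) - f x)
    \<le> ennreal (2 powr p * (a + 2 powr p * (2 * a)))"
proof -
  let ?N = "bessel_measure l"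
  note [measurable] = f g borel_measurable_bessel_shift[OF y f] borel_measurable_bessel_shift[OF y g]
  have "Lp_mass ?N p (\<lambda>x. f (x + y) - f x) \<le> ennreal (2 powr p) *
      (Lp_mass ?N p (\<lambda>x. f (x + y) - g (x + y)) + Lp_mass ?N p (\<lambda>x. g (x + y) - f x))"
    by (rule Lp_mass_diff_le[OF p]) measurable
  also have "\<dots> \<le> ennreal (2 powr p) * (ennreal a + ennreal (2 powr p) * (ennreal a + ennreal a))"
  proof (intro mult_left_mono add_mono)
    have "Lp_mass ?N p (\<lambda>x. f (x + y) - g (x + y)) \<le> Lp_mass ?N p (\<lambda>x. f x - g x)"
      by (rule Lp_mass_bessel_shift_le[OF l y, of "\<lambda>x. f x - g x"]) measurable
    then show "Lp_mass ?N p (\<lambda>x. f (x + y) - g (x + y)) \<le> ennreal a"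
      using fg by (rule order_trans)
    have "Lp_mass ?N p (\<lambda>x. g (x + y) - f x) \<le> ennreal (2 powr p) *
        (Lp_mass ?N p (\<lambda>x. g (x + y) - g x) + Lp_mass ?N p (\<lambda>x. g x - f x))"
      by (rule Lp_mass_diff_le[OF p]) measurable
    also have "\<dots> \<le> ennreal (2 powr p) * (ennreal a + ennreal a)"
      using fg gg by (intro mult_left_mono add_mono) (auto simp: Lp_mass_commute[of _ _ g f])
    finally show "Lp_mass ?N p (\<lambda>x. g (x + y) - f x) \<le> ennreal (2 powr p) * (ennreal a + ennreal a)" .
  qed simp_all
  also have "\<dots> = ennreal (2 powr p * (a + 2 powr p * (2 * a)))"
  proof -
    have "ennreal a + ennreal a = ennreal (2 * a)" using a by (simp flip: ennreal_plus)
    then show ?thesis using a by (simp flip: ennreal_mult ennreal_plus)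
  qed
  finally show ?thesis .
qed

text \<open>Finite-range functions of bounded support are dense and satisfy the claim; the
  perturbation bound carries it over. \<open>a\<close> is chosen so that this bound equals
  \<open>e\<close>.\<close>

lemma bessel_shift_continuous:
  assumes l: "0 \<le> l" and p: "0 < p" and f: "f \<in> Lp_fun (bessel_measure l) p" and e: "0 < e"
  shows "\<forall>\<^sub>F y in at_right 0. Lp_mass (bessel_measure l) p (\<lambda>x. f (x + y) - f x) \<le> ennreal e"
proof -
  define a where "a = e / (2 powr p * (1 + 2 powr p * 2))"
  have pos: "0 < 2 powr p * (1 + 2 powr p * 2)" by (simp add: add_pos_pos)
  then have a: "0 < a" using e by (simp add: a_def)
  have "a * (2 powr p * (1 + 2 powr p * 2)) = e" using pos by (metis a_def nonzero_eq_divide_eq less_irrefl)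
  then have ae: "2 powr p * (a + 2 powr p * (2 * a)) = e" by (simp add: algebra_simps)
  obtain g m where g: "g \<in> borel_measurable borel" "finite (range g)"
    "\<And>x. x \<notin> {0<..m} \<Longrightarrow> g x = 0" "Lp_mass (bessel_measure l) p (\<lambda>x. f x - g x) < ennreal a"
    by (rule bessel_finite_range_dense[OF p f a]) blast
  have "\<forall>\<^sub>F y in at_right 0. Lp_mass (bessel_measure l) p (\<lambda>x. g (x + y) - g x) \<le> ennreal a"
    using l p g a by (intro bessel_finite_range_shift) auto
  moreover have "\<forall>\<^sub>F y::real in at_right 0. 0 < y" by (simp add: eventually_at_filter)
  ultimately show ?thesis
  proof eventually_elim
    case (elim y)
    show ?case
      using bessel_shift_mass_perturb[of l p y f g a] l p elim a f[THEN Lp_funD] g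
        borel_measurable_bessel_of_borel[OF g(1), of l]
      unfolding ae by (simp add: less_imp_le)
  qed
qed

section \<open>Total boundedness\<close>

lemma small_multiple_less:
  fixes a K :: real
  assumes "0 < a" "0 < K"
  obtains e where "0 < e" "K * (2 * e) < a"
proof (rule that[of "a / (4 * K)"])
  show "0 < a / (4 * K)" using assms by simp
  show "K * (2 * (a / (4 * K))) < a" using assms by simp
qed

text \<open>Total boundedness asks for centres inside \<open>F\<close>, whereas the net consists of
  functions that are merely measurable. Each net function close to some member of \<open>F\<close>
  is replaced by one such member, at the cost of a further triangle inequality.\<close>

lemma Lp_totally_bounded_of_net:
  assumes p: "1 \<le> p" and F: "F \<subseteq> Lp_space M p"
    and net: "\<And>e. 0 < e \<Longrightarrow> \<exists>S. finite S \<and> S \<subseteq> borel_measurable M \<and>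
      (\<forall>f\<in>\<Union>F. \<exists>s\<in>S. Lp_mass M p (\<lambda>x. f x - s x) \<le> ennreal e)"
  shows "Lp_totally_bounded M p F"
proof -
  interpret L: Metric_space "Lp_space M p" "Lp_dist M p" by (rule Metric_space_Lp[OF p])
  have "\<exists>K. finite K \<and> K \<subseteq> F \<and> F \<subseteq> (\<Union>C\<in>K. L.mball C \<epsilon>)" if \<epsilon>: "0 < \<epsilon>" for \<epsilon> :: real
  proof -
    have "0 < \<epsilon> powr p" using \<epsilon> by simp
    moreover have "0 < (2::real) powr p" by simp
    ultimately obtain e where e: "0 < e" and e_less: "2 powr p * (2 * e) < \<epsilon> powr p"
      by (rule small_multiple_less)
    obtain S where S: "finite S" "S \<subseteq> borel_measurable M"
      "\<forall>f\<in>\<Union>F. \<exists>s\<in>S. Lp_mass M p (\<lambda>x. f x - s x) \<le> ennreal e"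
      using net[OF e] by (elim exE conjE) (rule that)
    define near where "near s C \<longleftrightarrow> C \<in> F \<and> (\<exists>f\<in>C. Lp_mass M p (\<lambda>x. f x - s x) \<le> ennreal e)" for s C
    define K where "K = (\<lambda>s. SOME C. near s C) ` {s \<in> S. \<exists>C. near s C}"
    have some: "near s (SOME C. near s C)" if "near s C" for s C
      using that by (rule someI)
    have "K \<subseteq> F" using some unfolding K_def near_def by blast
    moreover have "finite K" using S(1) by (simp add: K_def)
    moreover have "C \<in> (\<Union>C\<in>K. L.mball C \<epsilon>)" if C: "C \<in> F" for C
    proof -
      have CL: "C \<in> Lp_space M p" using C F by blast
      obtain f where f: "f \<in> C" "f \<in> Lp_fun M p" using Lp_space_rep[OF CL] by blast
      obtain s where s: "s \<in> S" "Lp_mass M p (\<lambda>x. f x - s x) \<le> ennreal e"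
        using S(3) C f(1) by blast
      then have near: "near s C" using C f(1) by (auto simp: near_def)
      define D where "D = (SOME C. near s C)"
      have "near s D" unfolding D_def by (rule some[OF near])
      then obtain g where g: "D \<in> F" "g \<in> D" "Lp_mass M p (\<lambda>x. g x - s x) \<le> ennreal e"
        by (auto simp: near_def)
      have DL: "D \<in> Lp_space M p" using g(1) F by blast
      have "Lp_mass M p (\<lambda>x. g x - f x)
          \<le> ennreal (2 powr p) * (Lp_mass M p (\<lambda>x. g x - s x) + Lp_mass M p (\<lambda>x. s x - f x))"
        using p S(2) s(1) f(2) Lp_space_repD(1)[OF DL g(2) g(2)]
        by (intro Lp_mass_diff_le) (auto dest: Lp_funD)
      also have "\<dots> \<le> ennreal (2 powr p) * (ennreal e + ennreal e)"
        using g(3) s(2) by (intro mult_left_mono add_mono) (auto simp: Lp_mass_commute[of _ _ s f])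
      also have "\<dots> = ennreal (2 powr p * (2 * e))"
        using e by (simp flip: ennreal_mult ennreal_plus)
      also have "\<dots> < ennreal (\<epsilon> powr p)"
        by (rule ennreal_lessI[OF _ e_less]) (use \<epsilon> in simp)
      finally have "Lp_dist M p D C < \<epsilon>"
        by (simp add: Lp_dist_less_iff[OF p DL CL g(2) f(1) \<epsilon>])
      moreover have "D \<in> K" unfolding K_def D_def using s(1) near by blast
      ultimately show ?thesis using CL DL by (auto simp: L.in_mball)
    qed
    ultimately show ?thesis by blast
  qed
  then show ?thesis by (simp add: L.mtotally_bounded_def)
qed

lemma Lp_totally_boundedD:
  assumes p: "1 \<le> p" and tb: "Lp_totally_bounded M p F" and e: "0 < e"
  obtains K where "finite K" "K \<subseteq> F"
    "\<And>C. C \<in> F \<Longrightarrow> \<exists>D\<in>K. \<forall>f\<in>C. \<forall>g\<in>D. Lp_mass M p (\<lambda>x. f x - g x) < ennreal e"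
proof -
  interpret L: Metric_space "Lp_space M p" "Lp_dist M p" by (rule Metric_space_Lp[OF p])
  have \<epsilon>: "0 < e powr (1 / p)" using e by simp
  have \<epsilon>p: "(e powr (1 / p)) powr p = e" using e p by (simp add: powr_powr)
  obtain K where K: "finite K" "K \<subseteq> F" "F \<subseteq> (\<Union>C\<in>K. L.mball C (e powr (1 / p)))"
    using tb[unfolded L.mtotally_bounded_def, rule_format, OF \<epsilon>] by (elim exE conjE) (rule that)
  have "\<exists>D\<in>K. \<forall>f\<in>C. \<forall>g\<in>D. Lp_mass M p (\<lambda>x. f x - g x) < ennreal e" if CF: "C \<in> F" for C
  proof -
    obtain D where D: "D \<in> K" "C \<in> L.mball D (e powr (1 / p))" using K(3) CF by blast
    then have "C \<in> Lp_space M p" "D \<in> Lp_space M p" "Lp_dist M p C D < e powr (1 / p)"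
      by (auto simp: L.in_mball L.commute)
    then have "\<forall>f\<in>C. \<forall>g\<in>D. Lp_mass M p (\<lambda>x. f x - g x) < ennreal e"
      using Lp_dist_less_iff[OF p _ _ _ _ \<epsilon>, of C M D] by (simp add: \<epsilon>p)
    with D(1) show ?thesis by (rule bexI[rotated])
  qed
  with K(1,2) show ?thesis by (rule that)
qed

lemma Lp_totally_bounded_norm_bounded:
  assumes p: "1 \<le> p" and tb: "Lp_totally_bounded M p F"
  obtains B where "\<And>C. C \<in> F \<Longrightarrow> Lp_norm M p C \<le> B"
proof -
  interpret L: Metric_space "Lp_space M p" "Lp_dist M p" by (rule Metric_space_Lp[OF p])
  obtain K where K: "finite K" "K \<subseteq> F" "F \<subseteq> (\<Union>C\<in>K. L.mball C 1)"
    using tb[unfolded L.mtotally_bounded_def, rule_format, OF zero_less_one] by (elim exE conjE) (rule that)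
  \<comment> \<open>If \<open>K\<close> is empty then so is \<open>F\<close>, so the maximum is used
    only over a nonempty set.\<close>
  have "Lp_norm M p C \<le> Max (Lp_norm M p ` K) + 1" if CF: "C \<in> F" for C
  proof -
    obtain D where D: "D \<in> K" "C \<in> L.mball D 1" using K(3) CF by blast
    then have CD: "C \<in> Lp_space M p" "D \<in> Lp_space M p" "Lp_dist M p C D < 1"
      by (auto simp: L.in_mball L.commute)
    obtain f where f: "f \<in> C" "f \<in> Lp_fun M p" using Lp_space_rep[OF CD(1)] by blast
    obtain g where g: "g \<in> D" "g \<in> Lp_fun M p" using Lp_space_rep[OF CD(2)] by blast
    have "Lp_norm M p C \<le> Lp_dist M p C D + Lp_norm M p D"
      using Lp_seminorm_triangle[OF p Lp_fun_diff[OF p f(2) g(2)] g(2)]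
      by (simp add: Lp_norm_eq[OF CD(1) f(1)] Lp_norm_eq[OF CD(2) g(1)]
          Lp_dist_eq[OF CD(1,2) f(1) g(1)])
    moreover have "Lp_norm M p D \<le> Max (Lp_norm M p ` K)" using K(1) D(1) by simp
    ultimately show ?thesis using CD(3) by linarith
  qed
  then show ?thesis by (rule that)
qed

section \<open>Uniform tail and translation bounds against total boundedness\<close>

lemma bessel_tail_perturb:
  assumes p: "0 \<le> p" and f [measurable]: "f \<in> borel_measurable (bessel_measure l)"
    and g [measurable]: "g \<in> borel_measurable (bessel_measure l)"
  shows "(\<integral>\<^sup>+x\<in>{M<..}. ennreal (norm (f x) powr p) \<partial>bessel_measure l) \<le> ennreal (2 powr p) *
    (Lp_mass (bessel_measure l) p (\<lambda>x. f x - g x) +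
     (\<integral>\<^sup>+x\<in>{M<..}. ennreal (norm (g x) powr p) \<partial>bessel_measure l))"
proof -
  let ?N = "bessel_measure l"
  note [measurable] = borel_measurable_bessel_of_borel[of "indicator {M<..} :: real \<Rightarrow> ennreal" l]
  have "(\<integral>\<^sup>+x\<in>{M<..}. ennreal (norm (f x) powr p) \<partial>?N) \<le> (\<integral>\<^sup>+x. ennreal (2 powr p) *
      (ennreal (norm (f x - g x) powr p) + ennreal (norm (g x) powr p) * indicator {M<..} x) \<partial>?N)"
  proof (intro nn_integral_mono)
    fix x
    show "ennreal (norm (f x) powr p) * indicator {M<..} x \<le> ennreal (2 powr p) *
      (ennreal (norm (f x - g x) powr p) + ennreal (norm (g x) powr p) * indicator {M<..} x)"
      using ennreal_norm_diff_powr_le[OF p, of "f x" 0 "g x"] by (simp split: split_indicator)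
  qed
  also have "\<dots> = ennreal (2 powr p) * (Lp_mass ?N p (\<lambda>x. f x - g x) +
      (\<integral>\<^sup>+x\<in>{M<..}. ennreal (norm (g x) powr p) \<partial>?N))"
    by (simp add: nn_integral_cmult nn_integral_add Lp_mass_def)
  finally show ?thesis .
qed

lemma bessel_totally_bounded_tail:
  assumes p: "1 \<le> p" and tb: "Lp_totally_bounded (bessel_measure l) p F" and a: "0 < a"
    and F: "F \<subseteq> Lp_space (bessel_measure l) p"
  shows "\<exists>M>0. \<forall>C\<in>F. \<forall>f\<in>C.
    (\<integral>\<^sup>+x\<in>{M<..}. ennreal (norm (f x) powr p) \<partial>bessel_measure l) < ennreal a"
proof -
  let ?N = "bessel_measure l"
  have rep: "f \<in> Lp_fun ?N p" if "C \<in> F" "f \<in> C" for C f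
    using Lp_space_repD(1)[of C ?N p f f] F that by blast
  have "0 < (2::real) powr p" by simp
  with a obtain e where e: "0 < e" and e_less: "2 powr p * (2 * e) < a"
    by (rule small_multiple_less)
  obtain K where K: "finite K" "K \<subseteq> F"
    "\<And>C. C \<in> F \<Longrightarrow> \<exists>D\<in>K. \<forall>f\<in>C. \<forall>g\<in>D. Lp_mass ?N p (\<lambda>x. f x - g x) < ennreal e"
    by (rule Lp_totally_boundedD[OF p tb e]) (rule that)
  have "\<forall>D\<in>K. \<exists>g. g \<in> D" using K(2) F by (meson Lp_space_rep subsetD)
  then obtain g where g: "\<And>D. D \<in> K \<Longrightarrow> g D \<in> D" by metis
  have gL: "g D \<in> Lp_fun ?N p" if "D \<in> K" for D
    by (rule rep[OF subsetD[OF K(2) that] g[OF that]])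
  \<comment> \<open>Finitely many eventual bounds hold simultaneously, which supplies one cutoff for
    the entire net.\<close>
  have "\<forall>\<^sub>F M in at_top. \<forall>D\<in>K. (\<integral>\<^sup>+x\<in>{M<..}. ennreal (norm (g D x) powr p) \<partial>?N) < ennreal e"
    by (intro eventually_ball_finite ballI bessel_tail_tendsto[OF gL e] K(1))
  moreover have "\<forall>\<^sub>F M::real in at_top. 0 < M" by (rule eventually_gt_at_top)
  ultimately have "\<forall>\<^sub>F M in at_top. 0 < M \<and>
      (\<forall>D\<in>K. (\<integral>\<^sup>+x\<in>{M<..}. ennreal (norm (g D x) powr p) \<partial>?N) < ennreal e)"
    by eventually_elim simp
  then obtain M where M: "0 < M"
    "\<And>D. D \<in> K \<Longrightarrow> (\<integral>\<^sup>+x\<in>{M<..}. ennreal (norm (g D x) powr p) \<partial>?N) < ennreal e"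
    by (auto dest: eventually_happens)
  have "(\<integral>\<^sup>+x\<in>{M<..}. ennreal (norm (f x) powr p) \<partial>?N) < ennreal a" if C: "C \<in> F" "f \<in> C" for C f
  proof -
    obtain D where D: "D \<in> K" "Lp_mass ?N p (\<lambda>x. f x - g D x) < ennreal e"
      using K(3)[OF C(1)] C(2) g by blast
    have "(\<integral>\<^sup>+x\<in>{M<..}. ennreal (norm (f x) powr p) \<partial>?N) \<le> ennreal (2 powr p) *
        (Lp_mass ?N p (\<lambda>x. f x - g D x) + (\<integral>\<^sup>+x\<in>{M<..}. ennreal (norm (g D x) powr p) \<partial>?N))"
      using p by (intro bessel_tail_perturb Lp_funD[OF rep[OF C]] Lp_funD[OF gL[OF D(1)]]) simp
    also have "\<dots> \<le> ennreal (2 powr p) * (ennreal e + ennreal e)"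
      using D(2) M(2)[OF D(1)] by (intro mult_left_mono add_mono) (auto simp: less_imp_le)
    also have "\<dots> = ennreal (2 powr p * (2 * e))"
      using e by (simp flip: ennreal_mult ennreal_plus)
    also have "\<dots> < ennreal a" by (rule ennreal_lessI[OF a e_less])
    finally show ?thesis .
  qed
  then show ?thesis using M(1) by blast
qed

lemma bessel_totally_bounded_shift:
  assumes l: "0 \<le> l" and p: "1 \<le> p" and tb: "Lp_totally_bounded (bessel_measure l) p F"
    and a: "0 < a" and F: "F \<subseteq> Lp_space (bessel_measure l) p"
  shows "\<exists>\<rho>>0. \<forall>C\<in>F. \<forall>f\<in>C. \<forall>y. 0 < y \<and> y < \<rho> \<longrightarrow>
    Lp_mass (bessel_measure l) p (\<lambda>x. f (x + y) - f x) < ennreal a"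
proof -
  let ?N = "bessel_measure l"
  have rep: "f \<in> Lp_fun ?N p" if "C \<in> F" "f \<in> C" for C f
    using Lp_space_repD(1)[of C ?N p f f] F that by blast
  have pos: "0 < 2 powr p * (1 + 2 powr p * 2)" by (simp add: add_pos_pos)
  \<comment> \<open>\<open>e\<close> is tuned to the constant of
    \<open>bessel_shift_mass_perturb\<close>; the spare factor 2 is dropped below.\<close>
  obtain e where e: "0 < e" and e_less2: "2 powr p * (1 + 2 powr p * 2) * (2 * e) < a"
    by (rule small_multiple_less[OF a pos])
  have "2 powr p * (e + 2 powr p * (2 * e)) = 2 powr p * (1 + 2 powr p * 2) * e"
    by (simp only: algebra_simps)
  also have "\<dots> \<le> 2 powr p * (1 + 2 powr p * 2) * (2 * e)"
    using e pos by (intro mult_left_mono) auto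
  also note e_less2
  finally have e_less: "2 powr p * (e + 2 powr p * (2 * e)) < a" .
  obtain K where K: "finite K" "K \<subseteq> F"
    "\<And>C. C \<in> F \<Longrightarrow> \<exists>D\<in>K. \<forall>f\<in>C. \<forall>g\<in>D. Lp_mass ?N p (\<lambda>x. f x - g x) < ennreal e"
    by (rule Lp_totally_boundedD[OF p tb e]) (rule that)
  have "\<forall>D\<in>K. \<exists>g. g \<in> D" using K(2) F by (meson Lp_space_rep subsetD)
  then obtain g where g: "\<And>D. D \<in> K \<Longrightarrow> g D \<in> D" by metis
  have gL: "g D \<in> Lp_fun ?N p" if "D \<in> K" for D
    by (rule rep[OF subsetD[OF K(2) that] g[OF that]])
  have "\<forall>\<^sub>F y in at_right 0. \<forall>D\<in>K. Lp_mass ?N p (\<lambda>x. g D (x + y) - g D x) \<le> ennreal e"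
    using l p by (intro eventually_ball_finite ballI bessel_shift_continuous gL e K(1)) auto
  then obtain \<rho> where \<rho>: "0 < \<rho>" "\<And>y D. 0 < y \<Longrightarrow> y < \<rho> \<Longrightarrow> D \<in> K \<Longrightarrow>
      Lp_mass ?N p (\<lambda>x. g D (x + y) - g D x) \<le> ennreal e"
    unfolding eventually_at_right_field by blast
  have "Lp_mass ?N p (\<lambda>x. f (x + y) - f x) < ennreal a"
    if C: "C \<in> F" "f \<in> C" and y: "0 < y" "y < \<rho>" for C f y
  proof -
    obtain D where D: "D \<in> K" "Lp_mass ?N p (\<lambda>x. f x - g D x) < ennreal e"
      using K(3)[OF C(1)] C(2) g by blast
    have "Lp_mass ?N p (\<lambda>x. f (x + y) - f x) \<le> ennreal (2 powr p * (e + 2 powr p * (2 * e)))"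
    proof (rule bessel_shift_mass_perturb)
      show "f \<in> borel_measurable ?N" by (rule Lp_funD[OF rep[OF C]])
      show "g D \<in> borel_measurable ?N" by (rule Lp_funD[OF gL[OF D(1)]])
      show "Lp_mass ?N p (\<lambda>x. f x - g D x) \<le> ennreal e" by (rule less_imp_le[OF D(2)])
      show "Lp_mass ?N p (\<lambda>x. g D (x + y) - g D x) \<le> ennreal e" by (rule \<rho>(2)[OF y D(1)])
    qed (use l p y e in auto)
    also have "\<dots> < ennreal a" by (rule ennreal_lessI[OF a e_less])
    finally show ?thesis .
  qed
  then show ?thesis using \<rho>(1) by blast
qed

lemma bessel_totally_boundedI:
  assumes l: "0 < l" and p: "1 \<le> p" and F: "F \<subseteq> Lp_space (bessel_measure l) p"
    and bound: "\<And>C. C \<in> F \<Longrightarrow> Lp_norm (bessel_measure l) p C \<le> B"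
    and vanish: "\<And>a. 0 < a \<Longrightarrow> \<exists>M>0. \<forall>C\<in>F. \<forall>f\<in>C.
      (\<integral>\<^sup>+x\<in>{M<..}. ennreal (norm (f x) powr p) \<partial>bessel_measure l) < ennreal a"
    and equi: "\<And>a. 0 < a \<Longrightarrow> \<exists>\<rho>>0. \<forall>C\<in>F. \<forall>f\<in>C. \<forall>y. 0 < y \<and> y < \<rho> \<longrightarrow>
      Lp_mass (bessel_measure l) p (\<lambda>x. f (x + y) - f x) < ennreal a"
  shows "Lp_totally_bounded (bessel_measure l) p F"
proof (rule Lp_totally_bounded_of_net[OF p F])
  let ?N = "bessel_measure l"
  fix e :: real assume e: "0 < e"
  have rep: "f \<in> Lp_fun ?N p" if "C \<in> F" "f \<in> C" for C f
    using Lp_space_repD(1)[of C ?N p f f] F that by blast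
  show "\<exists>S. finite S \<and> S \<subseteq> borel_measurable ?N \<and>
      (\<forall>f\<in>\<Union>F. \<exists>s\<in>S. Lp_mass ?N p (\<lambda>x. f x - s x) \<le> ennreal e)"
  \<comment> \<open>\<open>B\<close> can be negative only if \<open>F\<close> is empty, and
    \<open>B powr p\<close> is nonnegative in any case.\<close>
  proof (rule bessel_finite_net[OF l _ _ _ _ _ _ e, where p = p and H = "\<Union>F" and B = "B powr p"])
    show "f \<in> borel_measurable ?N" if "f \<in> \<Union>F" for f
      using that rep by (auto dest: Lp_funD)
    show "Lp_mass ?N p f \<le> ennreal (B powr p)" if f: "f \<in> \<Union>F" for f
    proof -
      obtain C where C: "C \<in> F" "f \<in> C" using f by blast
      then have "Lp_seminorm ?N p f \<le> B"
        using bound[OF C(1)] Lp_norm_eq[of C ?N p f] F by auto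
      then show ?thesis
        using p rep[OF C] Lp_seminorm_nonneg[of ?N p f]
        by (simp add: Lp_mass_eq_seminorm ennreal_leI powr_mono2)
    qed
    show "\<exists>M>0. \<forall>f\<in>\<Union>F. (\<integral>\<^sup>+x\<in>{M<..}. ennreal (norm (f x) powr p) \<partial>?N) \<le> ennreal a" if "0 < a" for a
      using vanish[OF that] by (meson UnionE less_imp_le)
    show "\<exists>\<rho>>0. \<forall>f\<in>\<Union>F. \<forall>y. 0 < y \<and> y < \<rho> \<longrightarrow> Lp_mass ?N p (\<lambda>x. f (x + y) - f x) \<le> ennreal a"
      if "0 < a" for a
      using equi[OF that] by (meson UnionE less_imp_le)
    show "0 < p" "0 \<le> B powr p" using p by simp_all
    show "\<exists>S. finite S \<and> S \<subseteq> borel_measurable ?N \<and>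
        (\<forall>f\<in>\<Union>F. \<exists>s\<in>S. Lp_mass ?N p (\<lambda>x. f x - s x) \<le> ennreal e)"
      if "finite S" "S \<subseteq> borel_measurable ?N"
        "\<And>f. f \<in> \<Union>F \<Longrightarrow> \<exists>s\<in>S. Lp_mass ?N p (\<lambda>x. f x - s x) \<le> ennreal e" for S
      by (intro exI[of _ S] conjI ballI that)
  qed
qed

text \<open>The p-th power maps the positive reals onto themselves, so each
  \<open>\<epsilon> powr p\<close> can become an arbitrary positive bound on a mass.\<close>

lemma all_powr_iff:
  assumes "0 < (p::real)"
  shows "(\<forall>\<epsilon>>0. P (\<epsilon> powr p)) \<longleftrightarrow> (\<forall>a>0. P a)"
proof (intro iffI allI impI)
  fix a :: real assume P: "\<forall>\<epsilon>>0. P (\<epsilon> powr p)" and a: "0 < a"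
  have "(a powr (1 / p)) powr p = a" using assms a by (simp add: powr_powr)
  then show "P a" using P a by (metis powr_gt_zero less_irrefl)
qed auto

theorem theorem4p2:
  fixes l p :: real and F :: "(real \<Rightarrow> complex) set set"
  assumes "0 < l" and "1 < p" and "F \<subseteq> Lp_space (bessel_measure l) p"
  shows "(Lp_totally_bounded (bessel_measure l) p F \<longleftrightarrow>
           compactin (Lp_topology (bessel_measure l) p)
             (Lp_topology (bessel_measure l) p closure_of F)) \<and>
         (Lp_totally_bounded (bessel_measure l) p F \<longleftrightarrow>
           (SUP C\<in>F. ennreal (Lp_norm (bessel_measure l) p C)) < \<infinity> \<and>
           (\<forall>\<epsilon>>0. \<exists>M>0. \<forall>C\<in>F. \<forall>f\<in>C.
             (\<integral>\<^sup>+x\<in>{M<..}. ennreal (norm (f x) powr p * x powr (2 * l)) \<partial>lborel)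
               < ennreal (\<epsilon> powr p)) \<and>
           (\<forall>\<epsilon>>0. \<exists>\<rho>>0. \<forall>C\<in>F. \<forall>f\<in>C. \<forall>y. 0 < y \<and> y < \<rho> \<longrightarrow>
             (\<integral>\<^sup>+x\<in>{0<..}. ennreal (norm (f (x + y) - f x) powr p * x powr (2 * l)) \<partial>lborel)
               < ennreal (\<epsilon> powr p)))"
proof
  let ?N = "bessel_measure l"
  have l: "0 < l" "0 \<le> l" and p: "1 \<le> p" "0 < p" and F: "F \<subseteq> Lp_space ?N p" using assms by auto
  interpret L: Metric_space "Lp_space ?N p" "Lp_dist ?N p" by (rule Metric_space_Lp[OF p(1)])
  \<comment> \<open>In a complete space the totally bounded subsets are those with compact
    closure.\<close>
  show "Lp_totally_bounded ?N p F \<longleftrightarrow> compactin L.mtopology (L.mtopology closure_of F)"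
    using L.mtotally_bounded_eq_compact_closure_of[OF mcomplete_Lp[OF p(1)]] F by blast
  have meas: "f \<in> borel_measurable ?N" if "C \<in> F" "f \<in> C" for C f
    using Lp_space_repD(1)[of C ?N p f f] F that by (auto dest: Lp_funD)
  have b_iff: "(\<forall>\<epsilon>>0. \<exists>M>0. \<forall>C\<in>F. \<forall>f\<in>C.
        (\<integral>\<^sup>+x\<in>{M<..}. ennreal (norm (f x) powr p * x powr (2 * l)) \<partial>lborel) < ennreal (\<epsilon> powr p))
      \<longleftrightarrow> (\<forall>a>0. \<exists>M>0. \<forall>C\<in>F. \<forall>f\<in>C.
        (\<integral>\<^sup>+x\<in>{M<..}. ennreal (norm (f x) powr p) \<partial>?N) < ennreal a)"
    unfolding all_powr_iff[OF p(2), of "\<lambda>a. \<exists>M>0. \<forall>C\<in>F. \<forall>f\<in>C.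
        (\<integral>\<^sup>+x\<in>{M<..}. ennreal (norm (f x) powr p * x powr (2 * l)) \<partial>lborel) < ennreal a"]
    using meas by (simp add: bessel_tail_eq cong: conj_cong)
  have c_iff: "(\<forall>\<epsilon>>0. \<exists>\<rho>>0. \<forall>C\<in>F. \<forall>f\<in>C. \<forall>y. 0 < y \<and> y < \<rho> \<longrightarrow>
        (\<integral>\<^sup>+x\<in>{0<..}. ennreal (norm (f (x + y) - f x) powr p * x powr (2 * l)) \<partial>lborel)
          < ennreal (\<epsilon> powr p))
      \<longleftrightarrow> (\<forall>a>0. \<exists>\<rho>>0. \<forall>C\<in>F. \<forall>f\<in>C. \<forall>y. 0 < y \<and> y < \<rho> \<longrightarrow>
        Lp_mass ?N p (\<lambda>x. f (x + y) - f x) < ennreal a)"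
    unfolding all_powr_iff[OF p(2), of "\<lambda>a. \<exists>\<rho>>0. \<forall>C\<in>F. \<forall>f\<in>C. \<forall>y. 0 < y \<and> y < \<rho> \<longrightarrow>
        (\<integral>\<^sup>+x\<in>{0<..}. ennreal (norm (f (x + y) - f x) powr p * x powr (2 * l)) \<partial>lborel) < ennreal a"]
    using meas by (simp add: bessel_shift_mass_eq)
  \<comment> \<open>The supremum is taken in \<open>ennreal\<close>, so that it exists for unbounded
    families and is 0 for the empty one.\<close>
  have a_iff: "(SUP C\<in>F. ennreal (Lp_norm ?N p C)) < \<infinity> \<longleftrightarrow> (\<exists>B. \<forall>C\<in>F. Lp_norm ?N p C \<le> B)"
  proof
    assume "(SUP C\<in>F. ennreal (Lp_norm ?N p C)) < \<infinity>"
    then obtain B where B: "0 \<le> B" "(SUP C\<in>F. ennreal (Lp_norm ?N p C)) = ennreal B"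
      by (cases "SUP C\<in>F. ennreal (Lp_norm ?N p C)") auto
    then have "ennreal (Lp_norm ?N p C) \<le> ennreal B" if "C \<in> F" for C
      using SUP_upper[OF that, of "\<lambda>C. ennreal (Lp_norm ?N p C)"] by simp
    then show "\<exists>B. \<forall>C\<in>F. Lp_norm ?N p C \<le> B" using B(1) by (auto simp: ennreal_le_iff)
  next
    assume "\<exists>B. \<forall>C\<in>F. Lp_norm ?N p C \<le> B"
    then obtain B where "\<forall>C\<in>F. Lp_norm ?N p C \<le> B" by blast
    then have "(SUP C\<in>F. ennreal (Lp_norm ?N p C)) \<le> ennreal B"
      by (intro SUP_least ennreal_leI) auto
    then show "(SUP C\<in>F. ennreal (Lp_norm ?N p C)) < \<infinity>"
      by (simp add: le_less_trans)
  qed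
  show "Lp_totally_bounded ?N p F \<longleftrightarrow>
           (SUP C\<in>F. ennreal (Lp_norm ?N p C)) < \<infinity> \<and>
           (\<forall>\<epsilon>>0. \<exists>M>0. \<forall>C\<in>F. \<forall>f\<in>C.
             (\<integral>\<^sup>+x\<in>{M<..}. ennreal (norm (f x) powr p * x powr (2 * l)) \<partial>lborel)
               < ennreal (\<epsilon> powr p)) \<and>
           (\<forall>\<epsilon>>0. \<exists>\<rho>>0. \<forall>C\<in>F. \<forall>f\<in>C. \<forall>y. 0 < y \<and> y < \<rho> \<longrightarrow>
             (\<integral>\<^sup>+x\<in>{0<..}. ennreal (norm (f (x + y) - f x) powr p * x powr (2 * l)) \<partial>lborel)
               < ennreal (\<epsilon> powr p))"
    unfolding a_iff b_iff c_iff
  proof (intro iffI conjI)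
    assume tb: "Lp_totally_bounded ?N p F"
    show "\<exists>B. \<forall>C\<in>F. Lp_norm ?N p C \<le> B"
      by (rule Lp_totally_bounded_norm_bounded[OF p(1) tb]) (intro exI ballI)
    show "\<forall>a>0. \<exists>M>0. \<forall>C\<in>F. \<forall>f\<in>C.
        (\<integral>\<^sup>+x\<in>{M<..}. ennreal (norm (f x) powr p) \<partial>?N) < ennreal a"
      by (intro allI impI bessel_totally_bounded_tail[OF p(1) tb _ F])
    show "\<forall>a>0. \<exists>\<rho>>0. \<forall>C\<in>F. \<forall>f\<in>C. \<forall>y. 0 < y \<and> y < \<rho> \<longrightarrow>
        Lp_mass ?N p (\<lambda>x. f (x + y) - f x) < ennreal a"
      by (rule allI, rule impI, rule bessel_totally_bounded_shift[OF l(2) p(1) tb _ F])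
  next
    assume h: "(\<exists>B. \<forall>C\<in>F. Lp_norm ?N p C \<le> B) \<and>
      (\<forall>a>0. \<exists>M>0. \<forall>C\<in>F. \<forall>f\<in>C. (\<integral>\<^sup>+x\<in>{M<..}. ennreal (norm (f x) powr p) \<partial>?N) < ennreal a) \<and>
      (\<forall>a>0. \<exists>\<rho>>0. \<forall>C\<in>F. \<forall>f\<in>C. \<forall>y. 0 < y \<and> y < \<rho> \<longrightarrow>
        Lp_mass ?N p (\<lambda>x. f (x + y) - f x) < ennreal a)"
    from h[THEN conjunct1] obtain B where B: "\<forall>C\<in>F. Lp_norm ?N p C \<le> B" ..
    show "Lp_totally_bounded ?N p F"
      by (rule bessel_totally_boundedI[OF l(1) p(1) F B[THEN bspec]
            h[THEN conjunct2, THEN conjunct1, THEN spec, THEN mp]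
            h[THEN conjunct2, THEN conjunct2, THEN spec, THEN mp]])
  qed
qed

end
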